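(* Let $k$ be the algebraic closure of $\mathbb{F}_3(t)$, the rational function field in one indeterminate over $\mathbb{F}_3$. Let $G$ be the subgroup of $\mathrm{GL}(k^3)$ generated by the matrices \[ \begin{bmatrix} 1 & 1 & 0 \\ 0 & 1 & 1 \\ 0 & 0 & 1 \end{bmatrix} \qquad\text{and}\qquad \begin{bmatrix} 1 & t & 0 \\ 0 & 1 & t \\ 0 & 0 & 1 \end{bmatrix}. \] Then $G$ is isomorphic to $\mathbb{Z}/3\mathbb{Z}\times\mathbb{Z}/3\mathbb{Z}$, and the invariant ring $(\mathrm{Sym}(k^3))^G$ for the natural action of $G$ on the polynomial ring $\mathrm{Sym}(k^3)$ does not have finite Frobenius representation type (FFRT).
   Context: Matrices act on $k^3$ by left multiplication on column vectors, and the action of $G$ on $k^3$ extends to an action on $\mathrm{Sym}(k^3)=k[x_1,x_2,x_3]$ by degree-preserving $k$-algebra automorphisms, where $x_1,x_2,x_3$ are the standard basis vectors of $k^3$. The polynomial ring has the standard $\mathbb{N}$-grading ($\deg x_i = 1$), and the invariant ring inherits this grading. FFRT: let $k$ be a perfect field of characteristic $p>0$, and let $R$ be a positively graded finitely generated commutative $k$-algebra (i.e., $R$ is $\mathbb{N}$-graded with $[R]_0=k$). For an integer $e\ge 0$, let ${}^eR=\{{}^er \mid r\in R\}$ be a copy of the ring $R$, regarded as an $R$-module via $r\cdot {}^es = {}^e(r^{p^e}s)$, with the $\mathbb{Q}$-grading in which $\deg {}^er = (\deg r)/p^e$ for $r$ homogeneous (for $R$ reduced, ${}^eR$ is identified with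 $R^{1/p^e}$, with ${}^er$ corresponding to $r^{1/p^e}$). For a $\mathbb{Q}$-graded module $M$ and $d\in\mathbb{Q}$, $M(d)$ denotes the degree shift $[M(d)]_i=[M]_{d+i}$. The ring $R$ has FFRT (in the graded sense) if there exist finitely many finitely generated $\mathbb{Q}$-graded $R$-modules $M_1,\dots,M_\ell$ such that for each $e\ge 1$, the module ${}^eR$ is isomorphic, as a $\mathbb{Q}$-graded $R$-module, to a finite direct sum of copies of modules of the form $M_i(d)$ with $1\le i\le \ell$ and $d\in\mathbb{Q}$. *)

theory Defs
  imports
    "HOL-Algebra.Algebra"
    "HOL-Algebra.Algebraic_Closure_Type"
    "HOL-Library.Poly_Mapping"
    "HOL-Analysis.Analysis"
    "Berlekamp_Zassenhaus.Finite_Field"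
begin

section \<open>The algebraic closure of \<open>F\<^sub>3(t)\<close>\<close>

text \<open>
  A type with three elements is needed only as an index: \<open>three mod_ring\<close> is the field with three
  elements.  The numeral type \<open>3\<close> cannot be used, as it is not an instance of \<open>prime_card\<close>.
\<close>

typedef three = "{0..<3::nat}"
  by (intro exI[of _ 0]) simp

lemma CARD_three [simp]: "CARD(three) = 3"
  by (simp add: type_definition.card[OF type_definition_three])

instance three :: finite
  by standard (simp add: card_ge_0_finite)

instance three :: prime_card
  by standard simp_all

type_synonym F3 = "three mod_ring"

type_synonym K = "F3 poly fract alg_closure"

lemma CHAR_K [simp]: "CHAR(K) = 3"
proof -
  have of_nat: "(of_nat n :: F3 poly fract) = Fraction_Field.Fract (of_nat n) 1" for n
    by (simp add: of_nat_fract)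
  have "CHAR(F3 poly fract) = CHAR(F3 poly)"
  proof (rule CHAR_eqI)
    show "of_nat CHAR(F3 poly) = (0 :: F3 poly fract)"
      by (simp only: of_nat of_nat_CHAR Zero_fract_def)
    show "CHAR(F3 poly) dvd n" if "of_nat n = (0 :: F3 poly fract)" for n
      using that unfolding of_nat by (simp add: eq_fract Zero_fract_def of_nat_eq_0_iff_char_dvd)
  qed
  thus ?thesis by simp
qed

definition t_K :: K
  where "t_K = to_ac (Fraction_Field.Fract [:0, 1:] 1)"


section \<open>The symmetric algebra, the action of matrices, and invariants\<close>

type_synonym ('v, 'a) mpoly = "('v \<Rightarrow>\<^sub>0 nat) \<Rightarrow>\<^sub>0 'a"

definition Const :: "'a::zero \<Rightarrow> ('v, 'a) mpoly"
  where "Const c = Poly_Mapping.single 0 c"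

definition Var :: "'v \<Rightarrow> ('v, 'a::zero_neq_one) mpoly"
  where "Var i = Poly_Mapping.single (Poly_Mapping.single i 1) 1"

text \<open>The inclusion of \<open>k\<^sup>n\<close> into \<open>Sym(k\<^sup>n)\<close>, sending the \<open>i\<close>-th standard basis vector to \<open>x\<^sub>i\<close>.\<close>

definition sym_incl :: "'a::comm_ring_1 ^ 'n \<Rightarrow> ('n::finite, 'a) mpoly"
  where "sym_incl v = (\<Sum>i\<in>UNIV. Const (v $ i) * Var i)"

text \<open>The algebra endomorphism of \<open>Sym(k\<^sup>n)\<close> with \<open>x\<^sub>j \<mapsto> g x\<^sub>j\<close>, that is, substitution of \<open>g x\<^sub>j\<close> for \<open>x\<^sub>j\<close>.\<close>

definition act :: "'a::comm_ring_1 ^ 'n ^ 'n \<Rightarrow> ('n::finite, 'a) mpoly \<Rightarrow> ('n, 'a) mpoly"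
  where "act g f = (\<Sum>m\<in>Poly_Mapping.keys f. Const (Poly_Mapping.lookup f m) *
      (\<Prod>j\<in>UNIV. sym_incl (g *v axis j 1) ^ Poly_Mapping.lookup m j))"

definition homogeneous_part :: "nat \<Rightarrow> ('v::finite, 'a::zero) mpoly set"
  where "homogeneous_part n =
    {f. \<forall>m\<in>Poly_Mapping.keys f. (\<Sum>i\<in>UNIV. Poly_Mapping.lookup m i) = n}"

definition general_linear :: "('a::comm_ring_1 ^ 'n::finite ^ 'n) monoid"
  where "general_linear = \<lparr>carrier = {A. invertible A}, monoid.mult = (**), one = mat 1\<rparr>"

record 'a graded_ring = "'a ring" +
  ring_part :: "nat \<Rightarrow> 'a set"

definition invariant_ring ::
    "('a::comm_ring_1 ^ 'n::finite ^ 'n, 'x) monoid_scheme \<Rightarrow> ('n, 'a) mpoly graded_ring"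
  where "invariant_ring G =
    \<lparr>carrier = {f. \<forall>g\<in>carrier G. act g f = f}, monoid.mult = (*), one = 1,
     ring.zero = 0, ring.add = (+),
     ring_part = (\<lambda>n. {f \<in> homogeneous_part n. \<forall>g\<in>carrier G. act g f = f})\<rparr>"


section \<open>Graded modules and finite Frobenius representation type\<close>

record ('a, 'm) graded_module = "('a, 'm) module" +
  part :: "rat \<Rightarrow> 'm set"

locale rat_graded_module = module R M
  for R :: "('a, 'r) graded_ring_scheme" (structure)
    and M :: "('a, 'm, 'y) graded_module_scheme" (structure) +
  assumes part_subgroup: "subgroup (part M q) (add_monoid M)"
    and part_decomposition: "x \<in> carrier M \<Longrightarrow>
      \<exists>!c. (\<forall>q. c q \<in> part M q) \<and> finite {q. c q \<noteq> \<zero>\<^bsub>M\<^esub>} \<and>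
        x = (\<Oplus>\<^bsub>M\<^esub>q\<in>{q. c q \<noteq> \<zero>\<^bsub>M\<^esub>}. c q)"
    and smult_part: "\<lbrakk>r \<in> ring_part R i; x \<in> part M q\<rbrakk> \<Longrightarrow> r \<odot>\<^bsub>M\<^esub> x \<in> part M (of_nat i + q)"

definition finitely_generated_module ::
    "('a, 'r) ring_scheme \<Rightarrow> ('a, 'm, 'y) module_scheme \<Rightarrow> bool"
  where "finitely_generated_module R M \<longleftrightarrow> (\<exists>S. finite S \<and> S \<subseteq> carrier M \<and>
    carrier M = {(\<Oplus>\<^bsub>M\<^esub>s\<in>S. c s \<odot>\<^bsub>M\<^esub> s) | c. c \<in> S \<rightarrow> carrier R})"

definition graded_module_iso ::
    "('a, 'r) ring_scheme \<Rightarrow> ('a, 'm) graded_module \<Rightarrow> ('a, 'n) graded_module \<Rightarrow> bool"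
  where "graded_module_iso R M N \<longleftrightarrow> (\<exists>\<phi>. bij_betw \<phi> (carrier M) (carrier N) \<and>
    (\<forall>x\<in>carrier M. \<forall>y\<in>carrier M. \<phi> (x \<oplus>\<^bsub>M\<^esub> y) = \<phi> x \<oplus>\<^bsub>N\<^esub> \<phi> y) \<and>
    (\<forall>r\<in>carrier R. \<forall>x\<in>carrier M. \<phi> (r \<odot>\<^bsub>M\<^esub> x) = r \<odot>\<^bsub>N\<^esub> \<phi> x) \<and>
    (\<forall>q. \<phi> ` part M q = part N q))"

definition shift_module :: "('a, 'm) graded_module \<Rightarrow> rat \<Rightarrow> ('a, 'm) graded_module"
  where "shift_module M d = M\<lparr>part := (\<lambda>i. part M (d + i))\<rparr>"

text \<open>
  Module records inherit the fields \<open>mult\<close> and \<open>one\<close> from ring records; they play no role for modules.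
\<close>

definition direct_sum_module ::
    "nat \<Rightarrow> (nat \<Rightarrow> ('a, 'm) graded_module) \<Rightarrow> ('a, nat \<Rightarrow> 'm) graded_module"
  where "direct_sum_module n N =
    \<lparr>carrier = (\<Pi>\<^sub>E j\<in>{..<n}. carrier (N j)), monoid.mult = undefined, one = undefined,
     ring.zero = (\<lambda>j\<in>{..<n}. \<zero>\<^bsub>N j\<^esub>),
     ring.add = (\<lambda>x y. \<lambda>j\<in>{..<n}. x j \<oplus>\<^bsub>N j\<^esub> y j),
     module.smult = (\<lambda>r x. \<lambda>j\<in>{..<n}. r \<odot>\<^bsub>N j\<^esub> x j),
     part = (\<lambda>q. \<Pi>\<^sub>E j\<in>{..<n}. part (N j) q)\<rparr>"

text \<open>
  The module \<open>\<^sup>eR\<close>.  The degree \<open>q\<close> part is \<open>[R]\<^sub>n\<close> if \<open>q = n / p\<^sup>e\<close> for a natural number \<open>n\<close>,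
  and zero if there is no such \<open>n\<close>.
\<close>

definition frobenius_module ::
    "nat \<Rightarrow> nat \<Rightarrow> ('a, 'r) graded_ring_scheme \<Rightarrow> ('a, 'a) graded_module"
  where "frobenius_module p e R =
    \<lparr>carrier = carrier R, monoid.mult = undefined, one = undefined,
     ring.zero = \<zero>\<^bsub>R\<^esub>, ring.add = add R,
     module.smult = (\<lambda>r s. (r [^]\<^bsub>R\<^esub> (p ^ e)) \<otimes>\<^bsub>R\<^esub> s),
     part = (\<lambda>q. {\<zero>\<^bsub>R\<^esub>} \<union> {s. \<exists>n. q = of_nat n / of_nat (p ^ e) \<and> s \<in> ring_part R n})\<rparr>"

text \<open>
  Here \<open>R\<close> is a positively graded finitely generated algebra over a perfect field of
  characteristic \<open>p\<close>.  The modules \<open>M\<^sub>1, \<dots>, M\<^sub>l\<close> have their elements in the type \<open>'m\<close>, since HOL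
  cannot quantify over types inside a formula.  That \<open>R\<close> does not have FFRT is therefore
  expressed by the negation for an arbitrary type \<open>'m\<close>; finitely many modules can always be
  represented with elements in one common type.
\<close>

definition has_FFRT :: "'m itself \<Rightarrow> nat \<Rightarrow> ('a, 'r) graded_ring_scheme \<Rightarrow> bool"
  where "has_FFRT _ p R \<longleftrightarrow> (\<exists>Ms :: ('a, 'm) graded_module list.
    (\<forall>M\<in>set Ms. rat_graded_module R M \<and> finitely_generated_module R M) \<and>
    (\<forall>e\<ge>1. \<exists>n N d. (\<forall>j<n. N j \<in> set Ms) \<and>
      graded_module_iso R (frobenius_module p e R)
        (direct_sum_module n (\<lambda>j. shift_module (N j) (d j)))))"


section \<open>The group\<close>

definition group_G :: "(K ^ 3 ^ 3) monoid"
  where "group_G = subgroup_generated general_linear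
    {vector [vector [1, 1, 0], vector [0, 1, 1], vector [0, 0, 1]],
     vector [vector [1, t_K, 0], vector [0, 1, t_K], vector [0, 0, 1]]}"

end

theory Submission
  imports Defs
begin

text \<open>
  Write \<open>S = k[x\<^sub>1, x\<^sub>2, x\<^sub>3]\<close> and \<open>R\<close> for the invariant ring.  The group consists of nine explicit
  unitriangular matrices, which gives the isomorphism type (\<open>group_G_iso\<close>).

  For FFRT, the idea is that \<open>\<^sup>eR\<close> remembers the Frobenius twist \<open>V\<^sub>e\<close> of \<open>V = k\<^sup>3\<close> in which \<open>t\<close> is replaced
  by its \<open>3\<^sup>e\<close>-th root.  As \<open>G\<close> contains no pseudoreflections, \<open>R\<close>-linear maps between the summands of the
  various \<open>\<^sup>eR\<close> come from \<open>G\<close>-equivariant maps over \<open>S\<close>, and in degree \<open>1/3\<^sup>e\<close> one finds the representation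
  \<open>V\<^sub>e\<close>.  These representations are indecomposable and pairwise nonisomorphic, so infinitely many different
  summands must occur.  The proof below follows a single element through this argument, namely the generator
  \<open>x\<^sub>1\<close> of \<open>[R]\<^sub>1\<close>, which spans the socle of each \<open>V\<^sub>e\<close>.

  In \<open>\<^sup>eR\<close> the element \<open>x\<^sub>1\<close> has degree \<open>1/3\<^sup>e\<close>, and \<open>\<^sup>eR\<close> vanishes in the degrees \<open>1/3\<^sup>e - i\<close> with \<open>i \<ge> 1\<close>.
  If \<open>\<^sup>eR\<close> is a direct sum of shifts of finitely generated modules \<open>M\<^sub>i\<close>, then \<open>x\<^sub>1\<close> has a nonzero component
  in some \<open>M\<^sub>i(d)\<close>, whose degree in \<open>M\<^sub>i\<close> must be a degree of a generator (\<open>lowest_degrees_finite\<close>).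
  With finitely many \<open>M\<^sub>i\<close>, the same \<open>M\<^sub>i\<close> and the same degree serve two exponents \<open>e < e'\<close>.  The composition
  \<open>\<^sup>eR \<rightarrow> M\<^sub>i \<rightarrow> \<^sup>e\<^sup>'R\<close> is an \<open>R\<close>-linear map that sends \<open>x\<^sub>1\<close> to a nonzero multiple of \<open>x\<^sub>1\<close>.

  Such a map does not exist (\<open>semilinear_map_kills_x1\<close>).  It would have to extend to an embedding of \<open>V\<^sub>e\<close> into
  \<open>V\<^sub>e\<^sub>'\<close>, but the action of the generators on \<open>x\<^sub>2\<close> distinguishes the two roots of \<open>t\<close>.  As \<open>x\<^sub>2\<close> is not
  invariant, it is replaced by invariants \<open>r\<^sup>q x\<^sub>2 - w\<^sup>q x\<^sub>1\<close>, where \<open>q = 3\<^sup>e\<close>; two of them, with coprime \<open>r\<close>,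
  suffice to recover the image of \<open>x\<^sub>2\<close> (\<open>cocycle_x1_squared\<close>, \<open>cocycle_trace\<close>).  That the factors \<open>r\<close> can be
  chosen coprime is where the absence of pseudoreflections is felt.
\<close>

section \<open>Linear substitutions\<close>

lemma Const_eq_iff [simp]: "Const a = Const b \<longleftrightarrow> a = b"
  unfolding Const_def by (metis lookup_single_eq)

lemma Const_0 [simp]: "Const 0 = 0"
  and Const_1 [simp]: "Const 1 = 1"
  by (simp_all add: Const_def)

lemma Const_eq_0_iff [simp]: "Const a = 0 \<longleftrightarrow> a = 0"
  by (metis Const_0 Const_eq_iff)

lemma Const_add [simp]: "Const (a + b) = Const a + Const b"
  and Const_diff [simp]: "Const (c - d) = Const c - Const (d :: 'a :: ab_group_add)"
  and Const_uminus [simp]: "Const (- d) = - Const d"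
  by (simp_all add: Const_def single_add single_diff single_uminus)

lemma Const_mult [simp]: "Const (a * b :: 'a :: comm_ring_1) = Const a * Const b"
  by (simp add: Const_def mult_single)

lemma Const_power [simp]: "Const (a ^ n :: 'a :: comm_ring_1) = Const a ^ n"
  by (induction n) simp_all

text \<open>
  The image under \<open>act g\<close> of the monomial with exponent \<open>m\<close>.  Naming it turns \<open>act g\<close> into a
  linear combination of multiplicative functions of the exponent.
\<close>

definition monom_value :: "'a::comm_ring_1 ^ 'n ^ 'n \<Rightarrow> ('n::finite \<Rightarrow>\<^sub>0 nat) \<Rightarrow> ('n, 'a) mpoly"
  where "monom_value g m = (\<Prod>j\<in>UNIV. sym_incl (g *v axis j 1) ^ Poly_Mapping.lookup m j)"

lemma monom_value_0 [simp]: "monom_value g 0 = 1"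
  and monom_value_add: "monom_value g (m + m') = monom_value g m * monom_value g m'"
  by (simp_all add: monom_value_def lookup_add power_add prod.distrib)

lemma act_superset:
  assumes "finite A" "Poly_Mapping.keys f \<subseteq> A"
  shows "act g f = (\<Sum>m\<in>A. Const (Poly_Mapping.lookup f m) * monom_value g m)"
  unfolding act_def monom_value_def
  using assms by (intro sum.mono_neutral_left) (auto simp: in_keys_iff)

lemma act_0 [simp]: "act g 0 = 0"
  by (simp add: act_def)

lemma act_single [simp]: "act g (Poly_Mapping.single m c) = Const c * monom_value g m"
  by (subst act_superset[of "{m}"]) auto

lemma act_add [simp]: "act g (f + f') = act g f + act g f'"
proof -
  let ?A = "Poly_Mapping.keys f \<union> Poly_Mapping.keys f'"
  have "Poly_Mapping.keys (f + f') \<subseteq> ?A" by (rule Poly_Mapping.keys_add)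
  thus ?thesis
    by (simp add: act_superset[of ?A] lookup_add sum.distrib[symmetric] algebra_simps)
qed

lemma act_sum: "act g (\<Sum>i\<in>I. f i) = (\<Sum>i\<in>I. act g (f i))"
  by (induction I rule: infinite_finite_induct) auto

lemma mpoly_eq_sum_singles:
  "f = (\<Sum>m\<in>Poly_Mapping.keys f. Poly_Mapping.single m (Poly_Mapping.lookup f m))"
  by (rule poly_mapping_eqI)
     (auto simp: lookup_sum lookup_single when_def in_keys_iff sum.delta)

lemma mpoly_induct [case_names single add]:
  assumes "\<And>m c. P (Poly_Mapping.single m c)" "\<And>f f'. P f \<Longrightarrow> P f' \<Longrightarrow> P (f + f')"
  shows "P (f :: ('n, 'a::comm_ring_1) mpoly)"
proof -
  have "P (\<Sum>m\<in>A. Poly_Mapping.single m (Poly_Mapping.lookup f m))" if "finite A" for A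
    using that assms(1)[of 0 0] by (induction rule: finite_induct) (auto intro: assms)
  thus ?thesis by (subst mpoly_eq_sum_singles) auto
qed

lemma act_mult [simp]: "act g (f * f') = act g f * act g f'"
proof (induction f rule: mpoly_induct)
  case (single m c)
  show ?case
    by (induction f' rule: mpoly_induct)
       (simp_all add: mult_single monom_value_add distrib_left distrib_right mult_ac)
qed (simp add: distrib_right)

lemma act_Const [simp]: "act g (Const c) = Const c"
  by (simp add: Const_def[where 'v='n] act_single)

lemma act_1 [simp]: "act g 1 = 1"
  using act_Const[of g 1] by simp

lemma act_uminus [simp]: "act g (- f) = - act g f"
  using act_add[of g f "- f"] by (simp add: eq_neg_iff_add_eq_0 add.commute)

lemma act_diff [simp]: "act g (f - f') = act g f - act g f'"
  using act_add[of g f "- f'"] by simp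

lemma act_power [simp]: "act g (f ^ n) = act g f ^ n"
  by (induction n) auto

lemma sym_incl_axis: "sym_incl (axis j 1 :: 'a::comm_ring_1 ^ 'n) = Var j"
proof -
  have "sym_incl (axis j 1 :: 'a ^ 'n) = (\<Sum>i\<in>UNIV. if i = j then Var i else 0)"
    unfolding sym_incl_def by (intro sum.cong) (auto simp: axis_def)
  thus ?thesis by simp
qed

lemma act_Var: "act g (Var j) = sym_incl (g *v axis j 1)"
proof -
  have "monom_value g (Poly_Mapping.single j 1) =
      (\<Prod>i\<in>UNIV. if i = j then sym_incl (g *v axis i 1) else 1)"
    unfolding monom_value_def by (intro prod.cong) (auto simp: lookup_single)
  thus ?thesis by (simp add: Var_def Const_def[symmetric] del: One_nat_def)
qed

lemma sym_incl_add: "sym_incl (v + w) = sym_incl v + sym_incl w"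
  by (simp add: sym_incl_def distrib_right sum.distrib)

lemma sym_incl_scale: "sym_incl (c *s v) = Const c * sym_incl v"
  by (simp add: sym_incl_def sum_distrib_left mult.assoc)

lemma sym_incl_0: "sym_incl 0 = 0"
  by (simp add: sym_incl_def)

lemma sym_incl_sum: "sym_incl (\<Sum>i\<in>I. v i) = (\<Sum>i\<in>I. sym_incl (v i))"
  by (induction I rule: infinite_finite_induct) (auto simp: sym_incl_add sym_incl_0)

lemma matrix_vector_mult_columns:
  "(g :: 'a::comm_ring_1 ^ 'n ^ 'n) *v v = (\<Sum>i\<in>UNIV. v $ i *s (g *v axis i 1))"
  by (simp add: vec_eq_iff matrix_vector_mult_def axis_def if_distrib cong: if_cong)
     (simp add: mult.commute)

lemma act_sym_incl: "act g (sym_incl v) = sym_incl (g *v v)"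
  by (subst matrix_vector_mult_columns)
     (simp add: sym_incl_def[of v] act_sum act_Var sym_incl_sum sym_incl_scale)

lemma mpoly_induct_algebra [case_names Const Var add mult]:
  assumes "\<And>c. P (Const c)" "\<And>j. P (Var j)" "\<And>f f'. P f \<Longrightarrow> P f' \<Longrightarrow> P (f + f')"
    and "\<And>f f'. P f \<Longrightarrow> P f' \<Longrightarrow> P (f * f')"
  shows "P (f :: ('n::finite, 'a::comm_ring_1) mpoly)"
proof (induction f rule: mpoly_induct)
  case (single m c)
  have pow: "P (x ^ n)" if "P x" for x n
    using that assms(1)[of 1] by (induction n) (auto intro: assms(4))
  have single_pow: "Var j ^ n = (Poly_Mapping.single (Poly_Mapping.single j n) 1 :: ('n,'a) mpoly)" for j n
  proof (induction n)
    case (Suc n)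
    thus ?case by (simp add: Var_def mult_single single_add[symmetric])
  qed simp
  have prod: "(\<Prod>j\<in>A. Var j ^ Poly_Mapping.lookup m j) =
      (Poly_Mapping.single (\<Sum>j\<in>A. Poly_Mapping.single j (Poly_Mapping.lookup m j)) 1 :: ('n,'a) mpoly)"
    if "finite A" for A
    using that by (induction rule: finite_induct) (simp_all add: single_pow mult_single)
  have m: "(\<Sum>j\<in>UNIV. Poly_Mapping.single j (Poly_Mapping.lookup m j)) = m"
    by (rule poly_mapping_eqI) (simp add: lookup_sum lookup_single when_def)
  have "P (\<Prod>j\<in>A. Var j ^ Poly_Mapping.lookup m j)" if "finite A" for A
    using that assms(1)[of 1] by (induction rule: finite_induct) (auto intro!: assms pow)
  hence "P (Const c * Poly_Mapping.single m 1)"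
    unfolding prod[of UNIV, unfolded m, simplified, symmetric] by (intro assms) auto
  thus ?case by (simp add: Const_def mult_single)
qed (rule assms)

lemma act_act: "act g (act h f) = act (g ** h) f"
  by (induction f rule: mpoly_induct_algebra)
     (simp_all add: act_Var act_sym_incl matrix_vector_mul_assoc)

lemma act_mat_1 [simp]: "act (mat 1) f = f"
  by (induction f rule: mpoly_induct_algebra) (simp_all add: act_Var sym_incl_axis)

section \<open>The grading of the symmetric algebra\<close>

definition total_degree :: "('v::finite \<Rightarrow>\<^sub>0 nat) \<Rightarrow> nat"
  where "total_degree m = (\<Sum>i\<in>UNIV. Poly_Mapping.lookup m i)"

lemma total_degree_add: "total_degree (m + m') = total_degree m + total_degree m'"
  by (simp add: total_degree_def lookup_add sum.distrib)

lemma total_degree_single [simp]: "total_degree (Poly_Mapping.single i n) = n"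
  by (simp add: total_degree_def lookup_single when_def)

lemma total_degree_0 [simp]: "total_degree 0 = 0"
  by (simp add: total_degree_def)

lemma homogeneous_part_alt:
  "homogeneous_part n = {f. \<forall>m\<in>Poly_Mapping.keys f. total_degree m = n}"
  by (simp add: homogeneous_part_def total_degree_def)

lemma homogeneous_part_0 [simp]: "0 \<in> homogeneous_part n"
  by (simp add: homogeneous_part_alt)

lemma homogeneous_part_add:
  "f \<in> homogeneous_part n \<Longrightarrow> f' \<in> homogeneous_part n \<Longrightarrow> f + f' \<in> homogeneous_part n"
  using Poly_Mapping.keys_add[of f f'] by (auto simp: homogeneous_part_alt)

lemma homogeneous_part_sum:
  "(\<And>i. i \<in> I \<Longrightarrow> f i \<in> homogeneous_part n) \<Longrightarrow> (\<Sum>i\<in>I. f i) \<in> homogeneous_part n"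
  by (induction I rule: infinite_finite_induct) (auto intro: homogeneous_part_add)

lemma homogeneous_part_mult:
  "f \<in> homogeneous_part n \<Longrightarrow> f' \<in> homogeneous_part n' \<Longrightarrow>
    f * f' \<in> homogeneous_part (n + n')"
  using Poly_Mapping.keys_mult[of f f'] by (fastforce simp: homogeneous_part_alt total_degree_add)

lemma homogeneous_part_Const: "Const c \<in> homogeneous_part 0"
  by (auto simp: homogeneous_part_alt Const_def split: if_splits)

lemma homogeneous_part_1: "1 \<in> homogeneous_part 0"
  by (metis Const_1 homogeneous_part_Const)

lemma homogeneous_part_Var: "Var i \<in> homogeneous_part 1"
  by (auto simp: homogeneous_part_alt Var_def)

lemma homogeneous_part_power:
  fixes f :: "('v::finite, 'a::comm_ring_1) mpoly"
  shows "f \<in> homogeneous_part n \<Longrightarrow> f ^ k \<in> homogeneous_part (k * n)"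
  using homogeneous_part_1
  by (induction k) (auto intro: homogeneous_part_mult)

lemma homogeneous_part_prod:
  fixes f :: "'i \<Rightarrow> ('v::finite, 'a::comm_ring_1) mpoly"
  assumes "\<And>i. i \<in> I \<Longrightarrow> f i \<in> homogeneous_part (d i)"
  shows "(\<Prod>i\<in>I. f i) \<in> homogeneous_part (\<Sum>i\<in>I. d i)"
  using assms homogeneous_part_1
  by (induction I rule: infinite_finite_induct) (auto intro: homogeneous_part_mult)

lemma homogeneous_part_sym_incl: "sym_incl v \<in> homogeneous_part 1"
  unfolding sym_incl_def
  by (intro homogeneous_part_sum)
     (use homogeneous_part_mult[OF homogeneous_part_Const homogeneous_part_Var] in simp)

lemma homogeneous_part_act:
  assumes "f \<in> homogeneous_part n"
  shows "act g f \<in> homogeneous_part n"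
proof -
  have mv: "monom_value g m \<in> homogeneous_part (total_degree m)" for m
    unfolding monom_value_def total_degree_def
    using homogeneous_part_power[OF homogeneous_part_sym_incl]
    by (intro homogeneous_part_prod) fastforce
  have "Const (Poly_Mapping.lookup f m) * monom_value g m \<in> homogeneous_part n"
    if "m \<in> Poly_Mapping.keys f" for m
    using homogeneous_part_mult[OF homogeneous_part_Const mv[of m]] that assms
    by (auto simp: homogeneous_part_alt)
  thus ?thesis
    by (subst act_superset[of "Poly_Mapping.keys f"]) (auto intro: homogeneous_part_sum)
qed

definition hom_component :: "nat \<Rightarrow> ('v::finite, 'a::comm_ring_1) mpoly \<Rightarrow> ('v, 'a) mpoly"
  where "hom_component n f = (\<Sum>m | m \<in> Poly_Mapping.keys f \<and> total_degree m = n.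
    Poly_Mapping.single m (Poly_Mapping.lookup f m))"

lemma lookup_hom_component:
  "Poly_Mapping.lookup (hom_component n f) m =
    (if total_degree m = n then Poly_Mapping.lookup f m else 0)"
  by (auto simp: hom_component_def lookup_sum lookup_single when_def in_keys_iff)

lemma hom_component_homogeneous: "hom_component n f \<in> homogeneous_part n"
  by (auto simp: homogeneous_part_alt in_keys_iff lookup_hom_component split: if_splits)

lemma hom_component_of_homogeneous:
  "f \<in> homogeneous_part n \<Longrightarrow> hom_component k f = (if k = n then f else 0)"
  by (auto intro!: poly_mapping_eqI simp: lookup_hom_component homogeneous_part_alt in_keys_iff)

lemma hom_component_sum:
  "hom_component n (\<Sum>i\<in>I. f i) = (\<Sum>i\<in>I. hom_component n (f i))"
  by (rule poly_mapping_eqI) (simp add: lookup_hom_component lookup_sum)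

lemma hom_component_add: "hom_component n (f + f') = hom_component n f + hom_component n f'"
  by (rule poly_mapping_eqI) (simp add: lookup_hom_component lookup_add)

lemma mpoly_eq_sum_hom_components:
  "f = (\<Sum>n\<in>total_degree ` Poly_Mapping.keys f. hom_component n f)"
proof (rule poly_mapping_eqI)
  fix m
  have "(\<Sum>n\<in>total_degree ` Poly_Mapping.keys f.
      if n = total_degree m then Poly_Mapping.lookup f m else 0) = Poly_Mapping.lookup f m"
    by (subst sum.delta) (auto simp: in_keys_iff)
  thus "Poly_Mapping.lookup f m =
      Poly_Mapping.lookup (\<Sum>n\<in>total_degree ` Poly_Mapping.keys f. hom_component n f) m"
    by (simp add: lookup_sum lookup_hom_component eq_commute[of "total_degree m"])
qed

text \<open>
  A linear substitution maps each homogeneous part to itself, so it can be applied degree by degree.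
\<close>

lemma hom_component_act: "hom_component n (act g f) = act g (hom_component n f)"
proof -
  let ?D = "total_degree ` Poly_Mapping.keys f"
  have "hom_component n (act g f) = (\<Sum>k\<in>?D. hom_component n (act g (hom_component k f)))"
    by (subst mpoly_eq_sum_hom_components[of f]) (simp only: act_sum hom_component_sum)
  also have "\<dots> = (\<Sum>k\<in>?D. act g (hom_component n (hom_component k f)))"
    by (intro sum.cong refl)
       (simp add: hom_component_of_homogeneous[OF hom_component_homogeneous]
          hom_component_of_homogeneous[OF homogeneous_part_act[OF hom_component_homogeneous]])
  also have "\<dots> = act g (hom_component n f)"
    by (subst (2) mpoly_eq_sum_hom_components[of f]) (simp only: act_sum hom_component_sum)
  finally show ?thesis .
qed

lemma lookup_sym_incl:
  fixes v :: "'a::comm_ring_1 ^ 'b::finite"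
  shows "Poly_Mapping.lookup (sym_incl v) (Poly_Mapping.single i 1) = v $ i"
proof -
  have "Const c * Var j = Poly_Mapping.single (Poly_Mapping.single j 1) c"
    for c :: 'a and j :: 'b
    by (simp add: Const_def Var_def mult_single)
  moreover have "(\<Sum>j\<in>UNIV. Poly_Mapping.lookup
      (Poly_Mapping.single (Poly_Mapping.single j 1) (v $ j)) (Poly_Mapping.single i (1::nat))) =
      (\<Sum>j\<in>UNIV. if j = i then v $ j else 0)"
    by (intro sum.cong) (auto simp: lookup_single when_def dest!: arg_cong[of _ _ Poly_Mapping.keys])
  ultimately show ?thesis by (simp add: sym_incl_def lookup_sum)
qed

lemma sym_incl_eq_iff [simp]: "sym_incl v = sym_incl w \<longleftrightarrow> v = w"
  by (metis lookup_sym_incl vec_eq_iff)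

lemma homogeneous_part_1_eq:
  "homogeneous_part 1 = range (sym_incl :: 'a::comm_ring_1 ^ 'v \<Rightarrow> ('v::finite, 'a) mpoly)"
proof (intro equalityI subsetI)
  fix f :: "('v, 'a) mpoly"
  assume f: "f \<in> homogeneous_part 1"
  have "Poly_Mapping.lookup f m = Poly_Mapping.lookup
      (sym_incl (\<chi> i. Poly_Mapping.lookup f (Poly_Mapping.single i 1))) m" for m
  proof (cases "total_degree m = 1")
    case True
    then obtain i where i: "Poly_Mapping.lookup m i = 1"
      "\<And>j. j \<noteq> i \<Longrightarrow> Poly_Mapping.lookup m j = 0"
      using sum_eq_1_iff[of UNIV "Poly_Mapping.lookup m"]
      unfolding total_degree_def by auto
    hence "m = Poly_Mapping.single i 1"
      by (intro poly_mapping_eqI) (auto simp: lookup_single when_def)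
    thus ?thesis by (simp only: lookup_sym_incl) simp
  next
    case False
    thus ?thesis
      using f homogeneous_part_sym_incl[of "\<chi> i. Poly_Mapping.lookup f (Poly_Mapping.single i 1)"]
      by (metis (mono_tags, lifting) homogeneous_part_alt in_keys_iff mem_Collect_eq)
  qed
  hence "f = sym_incl (\<chi> i. Poly_Mapping.lookup f (Poly_Mapping.single i 1))"
    by (rule poly_mapping_eqI)
  thus "f \<in> range sym_incl" by blast
qed (use homogeneous_part_sym_incl in auto)

section \<open>The element \<open>t\<close> and characteristic three\<close>

text \<open>
  The transcendence of \<open>t\<close> over \<open>F\<^sub>3\<close> enters the argument only in this form.  For \<open>n\<close> a power of three, it
  says that the iterated cube roots of \<open>t\<close> are pairwise different.
\<close>

lemma t_K_power_neq: assumes "n > 1" shows "t_K ^ n \<noteq> t_K"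
proof
  have pow: "Fraction_Field.Fract a 1 ^ n = Fraction_Field.Fract (a ^ n) 1" for a :: "F3 poly"
    by (induction n) (simp_all add: One_fract_def)
  assume "t_K ^ n = t_K"
  hence "Fraction_Field.Fract ([:0, 1:] ^ n) 1 = Fraction_Field.Fract ([:0, 1:] :: F3 poly) 1"
    unfolding t_K_def to_ac_power[symmetric] to_ac_eq_iff pow .
  hence "[:0, 1:] ^ n = ([:0, 1:] :: F3 poly)"
    by (simp add: eq_fract)
  hence "n = 1"
    by (metis degree_linear_power degree_pCons_eq_if degree_1 one_neq_zero One_nat_def pCons_one)
  thus False using assms by simp
qed

lemma CHAR_mpoly [simp]: "CHAR(('v, 'a::comm_ring_1) mpoly) = CHAR('a)"
proof (rule CHAR_eqI)
  have *: "(of_nat n :: ('v, 'a) mpoly) = Const (of_nat n)" for n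
    by (induction n) simp_all
  show "of_nat CHAR('a) = (0 :: ('v, 'a) mpoly)" by (simp add: *)
  show "CHAR('a) dvd n" if "of_nat n = (0 :: ('v, 'a) mpoly)" for n
    using that by (simp add: * of_nat_eq_0_iff_char_dvd)
qed

type_synonym S = "(3, K) mpoly"

lemma CHAR_S: "CHAR(S) = 3"
  by (simp only: CHAR_mpoly CHAR_K)

lemma frobenius_add: "(a + b :: S) ^ 3 ^ e = a ^ 3 ^ e + b ^ 3 ^ e"
  by (rule freshmans_dream'[of "3 ^ e" e]) (simp_all only: CHAR_S prime_nat_numeral_eq, simp_all)

lemma frobenius_uminus: "(- a :: S) ^ 3 ^ e = - (a ^ 3 ^ e)"
  by (simp add: power_minus_odd)

lemma frobenius_diff: "(a - b :: S) ^ 3 ^ e = a ^ 3 ^ e - b ^ 3 ^ e"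
  using frobenius_add[of a "- b" e] by (simp add: frobenius_uminus)

lemma three_K: "(3 :: K) = 0"
  using of_nat_CHAR[where 'a=K] by (simp only: CHAR_K of_nat_numeral)

lemma three_S: "(3 :: S) = 0"
  using of_nat_CHAR[where 'a=S] by (simp only: CHAR_S of_nat_numeral)

lemma t_K_neq: "t_K \<noteq> 0" "t_K \<noteq> 1" "t_K ^ 2 \<noteq> t_K" "t_K ^ 3 \<noteq> t_K" "t_K ^ 2 \<noteq> 1"
proof -
  show 3: "t_K ^ 3 \<noteq> t_K" and 2: "t_K ^ 2 \<noteq> t_K" using t_K_power_neq by auto
  thus "t_K \<noteq> 0" "t_K \<noteq> 1" by auto
  show "t_K ^ 2 \<noteq> 1" using 3 by (simp add: power3_eq_cube power2_eq_square)
qed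

section \<open>The generators of the group\<close>

definition jordan :: "'a::comm_ring_1 \<Rightarrow> 'a ^ 3 ^ 3"
  where "jordan s = vector [vector [1, s, 0], vector [0, 1, s], vector [0, 0, 1]]"

abbreviation x1 :: S where "x1 \<equiv> Var 1"
abbreviation x2 :: S where "x2 \<equiv> Var 2"
abbreviation x3 :: S where "x3 \<equiv> Var 3"

lemma jordan_vec: "jordan s *v v = vector [v$1 + s * v$2, v$2 + s * v$3, v$3]"
  by (simp add: jordan_def matrix_vector_mult_def vec_eq_iff sum_3 forall_3)

lemma sym_incl_vector: "sym_incl (vector [a, b, c] :: K ^ 3) = Const a * x1 + Const b * x2 + Const c * x3"
  by (simp add: sym_incl_def sum_3)

lemma act_jordan [simp]:
  "act (jordan s) x1 = x1" "act (jordan s) x2 = x2 + Const s * x1" "act (jordan s) x3 = x3 + Const s * x2"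
  by (simp_all add: act_Var jordan_vec axis_def sym_incl_vector add_ac)

lemma jordan_commute: "jordan s ** jordan t = jordan t ** jordan s"
  by (simp add: jordan_def matrix_matrix_mult_def vec_eq_iff sum_3 forall_3 algebra_simps)

lemma jordan_cubed: "jordan s ** (jordan s ** jordan s) = (mat 1 :: K ^ 3 ^ 3)"
proof -
  have "a + (a + a) = (0 :: K)" for a
  proof -
    have "a + (a + a) = 3 * a" by simp
    thus ?thesis by (simp only: three_K mult_zero_left)
  qed
  thus ?thesis
    by (simp add: jordan_def matrix_matrix_mult_def vec_eq_iff sum_3 forall_3 mat_def algebra_simps)
qed

section \<open>Lifts of additive characters\<close>

definition Inv :: "S set"
  where "Inv = {f. act (jordan 1) f = f \<and> act (jordan t_K) f = f}"

lemma Inv_closed [intro]: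
  "0 \<in> Inv" "x1 \<in> Inv" "f \<in> Inv \<Longrightarrow> f' \<in> Inv \<Longrightarrow> f + f' \<in> Inv" "f \<in> Inv \<Longrightarrow> f' \<in> Inv \<Longrightarrow> f - f' \<in> Inv"
  "f \<in> Inv \<Longrightarrow> - f \<in> Inv"
  "f \<in> Inv \<Longrightarrow> f' \<in> Inv \<Longrightarrow> f * f' \<in> Inv" "f \<in> Inv \<Longrightarrow> f ^ n \<in> Inv"
  by (auto simp: Inv_def)

text \<open>
  Call \<open>w\<close> a lift, with factor \<open>r\<close>, of an additive character \<open>\<lambda>'\<close> of the group if \<open>g w - w = \<lambda>' g \<cdot> r\<close> for
  all \<open>g\<close>.  Here \<open>\<lambda>'\<close> has the values \<open>1\<close> and \<open>\<theta>\<close> on the generators.  The \<open>(1, 2)\<close> entries of the matrices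
  form the character \<open>\<lambda>\<close> with values \<open>1\<close> and \<open>t\<close>, and \<open>x\<^sub>2\<close> lifts it with factor \<open>x\<^sub>1\<close>.  If \<open>\<theta>\<^sup>q = t\<close> for a
  power \<open>q\<close> of three, then \<open>w\<^sup>q\<close> lifts \<open>\<lambda>\<close> with factor \<open>r\<^sup>q\<close>, so that \<open>r\<^sup>q x\<^sub>2 - w\<^sup>q x\<^sub>1\<close> is invariant.
\<close>

definition cocycle :: "K \<Rightarrow> S \<Rightarrow> S \<Rightarrow> bool"
  where "cocycle \<theta> r w \<longleftrightarrow> r \<in> Inv \<and> act (jordan 1) w = w + r \<and>
    act (jordan t_K) w = w + Const \<theta> * r"

text \<open>
  Both \<open>x\<^sub>1 x\<^sub>2\<close> and, in characteristic three, \<open>x\<^sub>2\<^sup>2 + x\<^sub>1 x\<^sub>3\<close> are changed by multiples of \<open>x\<^sub>1\<^sup>2\<close>: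
  the generators add \<open>x\<^sub>1\<^sup>2\<close> and \<open>t x\<^sub>1\<^sup>2\<close> to the first, \<open>x\<^sub>1\<^sup>2\<close> and \<open>t\<^sup>2 x\<^sub>1\<^sup>2\<close> to the second.  As
  \<open>t\<^sup>2 \<noteq> t\<close>, an affine combination of the two realises any \<open>\<theta>\<close>.
\<close>

lemma cocycle_x1_squared: "\<exists>w. cocycle \<theta> (x1 ^ 2) w"
proof -
  define Q where "Q = x2 ^ 2 + x1 * x3"
  define \<alpha> where "\<alpha> = (\<theta> - t_K) / (t_K ^ 2 - t_K)"
  define w where "w = Const \<alpha> * Q + Const (1 - \<alpha>) * (x1 * x2)"
  have Q: "act (jordan s) Q = Q + Const (s ^ 2) * x1 ^ 2" for s
  proof -
    have "act (jordan s) Q = Q + Const (s ^ 2) * x1 ^ 2 + 3 * (Const s * x1 * x2)"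
      by (simp add: Q_def power2_eq_square algebra_simps)
    thus ?thesis by (simp only: three_S mult_zero_left add_0_right)
  qed
  have w: "act (jordan s) w = w + Const (\<alpha> * s ^ 2 + (1 - \<alpha>) * s) * x1 ^ 2" for s
    by (simp add: w_def Q power2_eq_square algebra_simps)
  have "\<alpha> * (t_K ^ 2 - t_K) = \<theta> - t_K"
    using t_K_neq by (simp add: \<alpha>_def)
  hence "\<alpha> * t_K ^ 2 + (1 - \<alpha>) * t_K = \<theta>"
    by (simp add: algebra_simps)
  hence "cocycle \<theta> (x1 ^ 2) w"
    unfolding cocycle_def w by auto
  thus ?thesis ..
qed

text \<open>
  For \<open>g\<^sup>3 = 1\<close> the orbit sum is the trace of the cyclic group generated by \<open>g\<close>.  The weighted sum is
  \<open>\<Sum>\<^sub>a a \<cdot> g\<^sup>a f\<close> over \<open>a \<in> F\<^sub>3\<close>, with \<open>2 = -1\<close>; shifting the summation index shows that \<open>g\<close> subtracts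
  the trace from it.
\<close>

definition orbit_sum :: "K ^ 3 ^ 3 \<Rightarrow> S \<Rightarrow> S"
  where "orbit_sum g f = f + act g f + act g (act g f)"

definition weighted_orbit_sum :: "K ^ 3 ^ 3 \<Rightarrow> S \<Rightarrow> S"
  where "weighted_orbit_sum g f = act g f - act g (act g f)"

lemma
  assumes "g ** (g ** g) = mat 1"
  shows act_orbit_sum: "act g (orbit_sum g f) = orbit_sum g f"
    and act_weighted_orbit_sum: "act g (weighted_orbit_sum g f) = weighted_orbit_sum g f - orbit_sum g f"
proof -
  have g3: "act g (act g (act g f)) = f"
    by (simp add: act_act assms)
  show "act g (orbit_sum g f) = orbit_sum g f"
    by (simp add: orbit_sum_def g3 add_ac)
  have "act g (weighted_orbit_sum g f) =
      weighted_orbit_sum g f - orbit_sum g f + 3 * act g (act g f)"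
    by (simp add: weighted_orbit_sum_def orbit_sum_def g3)
  thus "act g (weighted_orbit_sum g f) = weighted_orbit_sum g f - orbit_sum g f"
    by (simp only: three_S mult_zero_left add_0_right)
qed

lemma act_orbit_sum_commute:
  assumes "g ** h = h ** g"
  shows "act h (orbit_sum g f) = orbit_sum g (act h f)"
    and "act h (weighted_orbit_sum g f) = weighted_orbit_sum g (act h f)"
proof -
  have "act h (act g f) = act g (act h f)" for f
    by (simp add: act_act assms)
  thus "act h (orbit_sum g f) = orbit_sum g (act h f)"
    "act h (weighted_orbit_sum g f) = weighted_orbit_sum g (act h f)"
    by (simp_all add: orbit_sum_def weighted_orbit_sum_def)
qed

lemma Var_neq_0: "(Var i :: (_, 'a::zero_neq_one) mpoly) \<noteq> 0"
  by (simp add: Var_def) (metis lookup_single_eq lookup_zero one_neq_zero)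

lemmas x1_neq_0 [simp] = Var_neq_0[of 1, where 'a=K]
lemmas x2_neq_0 [simp] = Var_neq_0[of 2, where 'a=K]

text \<open>
  Splitting \<open>a\<^sup>8\<close> as \<open>(a\<^sup>3)\<^sup>2 a\<^sup>2\<close> and using additivity of cubes keeps the expansion small: only the
  power sums \<open>\<Sum>c\<^sup>2 = \<Sum>c\<^sup>4 = 2\<close> over \<open>c \<in> F\<^sub>3\<close> survive.
\<close>

lemma sum_eighth_powers:
  "y ^ 8 + (y + x) ^ 8 + (y + x + x) ^ 8 = - (x ^ 2 * (y ^ 6 + x ^ 2 * y ^ 4 + x ^ 4 * y ^ 2 + x ^ 6 :: S))"
proof -
  have eight: "a ^ 8 = (a ^ 3) ^ 2 * a ^ 2" for a :: S
    by (simp flip: power_mult power_add)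
  have cube: "(a + b) ^ 3 = a ^ 3 + b ^ 3" for a b :: S
    using frobenius_add[of a b 1] by simp
  have "B ^ 2 * y ^ 2 + (B + A) ^ 2 * (y + x) ^ 2 + (B + A + A) ^ 2 * (y + x + x) ^ 2 =
      - (A^2 * y^2 + A * B * x * y + B^2 * x^2 + A^2 * x^2) +
      3 * (B^2 * y^2 + 2 * B * y^2 * A + 2 * B^2 * x * y + 2 * A^2 * y^2 + 7 * A * B * x * y
        + 2 * B^2 * x^2 + 6 * A^2 * x * y + 6 * A * B * x^2 + 6 * A^2 * x^2)" for A B :: S
    by (simp add: power2_eq_square algebra_simps)
  note this[of "y ^ 3" "x ^ 3", unfolded three_S mult_zero_left add_0_right]
  thus ?thesis
    unfolding eight cube by (simp add: eval_nat_numeral algebra_simps)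
qed

lemma Const_numeral [simp]: "Const (numeral n :: 'a :: comm_ring_1) = numeral n"
proof -
  have "Const (of_nat k :: 'a) = of_nat k" for k
    by (induction k) simp_all
  from this[of "numeral n"] show ?thesis by simp
qed

lemma act_numeral [simp]: "act g (numeral n) = numeral n"
  using act_Const[of g "numeral n"] by simp

text \<open>
  Every trace \<open>r = \<Sum> g s\<close> over the group is the factor of a lift of every additive character, by the
  weighted sum \<open>w = - \<Sum> \<lambda>' g \<cdot> g s\<close>.  Since \<open>G\<close> acts faithfully modulo \<open>x\<^sub>1\<close>, some trace is not
  divisible by \<open>x\<^sub>1\<close>, and \<open>s = x\<^sub>3\<^sup>8\<close> will do: the coefficient of \<open>x\<^sub>2\<^sup>8\<close> in its trace is
  \<open>\<Sum> (a + b t)\<^sup>8\<close> over \<open>a, b \<in> F\<^sub>3\<close>, which equals \<open>t\<^sup>2 (t\<^sup>2 - 1)\<^sup>2\<close>.  The exponent eight is the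
  smallest one for which this power sum over nine elements does not vanish.
\<close>

lemma cocycle_trace: "\<exists>r w. cocycle \<theta> r w \<and> \<not> x1 dvd r"
proof -
  let ?g = "jordan (1 :: K)" and ?h = "jordan t_K"
  define s where "s = x3 ^ 8"
  define r where "r = orbit_sum ?g (orbit_sum ?h s)"
  define w where "w = - (weighted_orbit_sum ?g (orbit_sum ?h s)
    + Const \<theta> * orbit_sum ?g (weighted_orbit_sum ?h s))"
  note commute = act_orbit_sum_commute[OF jordan_commute[of 1 t_K]]
  note invariant = act_orbit_sum[OF jordan_cubed] act_weighted_orbit_sum[OF jordan_cubed]
  have diff: "orbit_sum ?g (f - f') = orbit_sum ?g f - orbit_sum ?g f'" for f f'
    by (simp add: orbit_sum_def)
  have "cocycle \<theta> r w"
    by (simp add: cocycle_def Inv_def r_def w_def commute invariant diff algebra_simps)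
  moreover have "\<not> x1 dvd r"
  proof
    \<comment> \<open>Set \<open>x\<^sub>1\<close> and \<open>x\<^sub>3\<close> to zero.\<close>
    define P :: "K ^ 3 ^ 3" where "P = vector [vector [0, 0, 0], vector [0, 1, 0], vector [0, 0, 0]]"
    have P: "act P x1 = 0" "act P x2 = x2" "act P x3 = 0"
      by (simp_all add: act_Var P_def matrix_vector_mult_def axis_def sum_3 sym_incl_def)
    assume "x1 dvd r"
    hence "act P r = 0" by (auto simp: dvd_def P)
    let ?T = "Const t_K * x2"
    \<comment> \<open>The three blocks belong to \<open>b = 0, 1, 2\<close>, and the terms of each block to \<open>a = 0, 1, 2\<close>.\<close>
    have "act P r = (0 ^ 8 + (0 + x2) ^ 8 + (0 + x2 + x2) ^ 8) + (?T ^ 8 + (?T + x2) ^ 8 + (?T + x2 + x2) ^ 8)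
      + ((?T + ?T) ^ 8 + ((?T + ?T) + x2) ^ 8 + ((?T + ?T) + x2 + x2) ^ 8)"
      by (simp add: r_def s_def orbit_sum_def P add_ac)
    also have "\<dots> = Const (t_K ^ 2 * (t_K ^ 2 - 1) ^ 2) * x2 ^ 8
        + 3 * (- (22 * Const t_K ^ 6 + 5 * Const t_K ^ 4 + 2 * Const t_K ^ 2 + 1) * x2 ^ 8)"
      unfolding sum_eighth_powers by (simp add: eval_nat_numeral algebra_simps)
    finally have "act P r = Const (t_K ^ 2 * (t_K ^ 2 - 1) ^ 2) * x2 ^ 8"
      by (simp only: three_S mult_zero_left add_0_right)
    with \<open>act P r = 0\<close> show False
      using t_K_neq by (simp add: x2_neq_0 Const_power[symmetric] Const_1[symmetric] del: Const_power Const_1)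
  qed
  ultimately show ?thesis by blast
qed

section \<open>Divisibility by \<open>x\<^sub>1\<close>\<close>

text \<open>
  The kernel of the substitution \<open>x\<^sub>1 \<mapsto> 0\<close> is generated by \<open>x\<^sub>1\<close>, and its values lie in a domain.
\<close>

lemma x1_dvd_mult: assumes "x1 dvd f * f'" shows "x1 dvd f \<or> x1 dvd f'"
proof -
  define P :: "K ^ 3 ^ 3" where "P = vector [vector [0, 0, 0], vector [0, 1, 0], vector [0, 0, 1]]"
  have P: "act P x1 = 0" "act P x2 = x2" "act P x3 = x3"
    by (simp_all add: act_Var P_def matrix_vector_mult_def axis_def sum_3 sym_incl_def)
  \<comment> \<open>Modulo \<open>x\<^sub>1\<close> the substitution is the identity; this passes from the variables to all polynomials.\<close>
  have "x1 dvd f - act P f" for f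
  proof (induction f rule: mpoly_induct_algebra)
    case (Var j)
    show ?case using exhaust_3[of j] by (auto simp: P)
  next
    case (add f f')
    from dvd_add[OF this] show ?case by (simp add: algebra_simps)
  next
    case (mult f f')
    have "f * f' - act P (f * f') = f * (f' - act P f') + (f - act P f) * act P f'"
      by (simp add: algebra_simps)
    thus ?case using mult by simp
  qed simp
  hence "x1 dvd f" if "act P f = 0" for f
    using that by (metis diff_zero)
  moreover have "act P f = 0" if "x1 dvd f" for f
    using that P(1) by (auto elim!: dvdE)
  ultimately have "x1 dvd f \<longleftrightarrow> act P f = 0" for f
    by blast
  thus ?thesis using assms by (simp only: act_mult mult_eq_0_iff)
qed

lemma x1_power_dvd_cancel:
  assumes "\<not> x1 dvd r" "x1 ^ n dvd r * f"
  shows "x1 ^ n dvd f"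
  using assms(2)
proof (induction n arbitrary: f)
  case (Suc n)
  from Suc.prems have "x1 dvd r * f" by (auto elim: dvd_mult_left)
  with x1_dvd_mult assms(1) obtain f' where f: "f = x1 * f'" by (auto simp: dvd_def)
  from Suc.prems obtain c where "r * f = x1 ^ Suc n * c" by (auto simp: dvd_def)
  hence "x1 * (r * f') = x1 * (x1 ^ n * c)" by (simp add: f mult_ac)
  hence "r * f' = x1 ^ n * c" by (simp only: mult_left_cancel[OF x1_neq_0])
  hence "x1 ^ n dvd f'" by (rule Suc.IH[OF dvdI])
  thus ?case by (simp add: f mult_dvd_mono)
qed simp

lemma x1_not_dvd_power: "\<not> x1 dvd r \<Longrightarrow> \<not> x1 dvd r ^ n"
proof (induction n)
  case 0
  show ?case
  proof
    assume "x1 dvd r ^ 0"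
    then obtain c where "1 = x1 * c" by (auto simp: dvd_def)
    \<comment> \<open>The zero matrix evaluates a polynomial at the origin.\<close>
    hence "act 0 (x1 * c) = 1" by (metis act_1)
    thus False by (simp add: act_Var sym_incl_0)
  qed
qed (use x1_dvd_mult in auto)

section \<open>Linear maps between different Frobenius twists\<close>

lemma K_root_exists: "\<exists>\<theta> :: K. \<theta> ^ 3 ^ e = c"
  by (rule nth_root_exists) simp

text \<open>
  Only the linear part \<open>v\<close> of \<open>b\<close> matters.  The hypotheses force its \<open>x\<^sub>3\<close> coefficient to vanish, and then
  the generators move it by \<open>v\<^sub>2 x\<^sub>1\<close> and \<open>t v\<^sub>2 x\<^sub>1\<close>.
\<close>

lemma translation_ratio_eq_t:
  assumes "act (jordan 1) b = b + Const c * x1" "act (jordan t_K) b = b + Const (c * u) * x1"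
    and "c \<noteq> 0"
  shows "u = t_K"
proof -
  obtain v where v: "hom_component 1 b = sym_incl v"
    using hom_component_homogeneous[of 1 b] unfolding homogeneous_part_1_eq by blast
  have x1: "Const a * x1 = sym_incl (vector [a, 0, 0])" for a
    by (simp add: sym_incl_vector)
  have "sym_incl (jordan s *v v) = sym_incl (v + vector [a, 0, 0])"
    if "act (jordan s) b = b + Const a * x1" for s a
  proof -
    have "hom_component 1 (sym_incl (vector [a, 0, 0] :: K ^ 3)) = sym_incl (vector [a, 0, 0])"
      using hom_component_of_homogeneous[OF homogeneous_part_sym_incl] by metis
    thus ?thesis
      using arg_cong[OF that, of "hom_component 1"]
      unfolding hom_component_act hom_component_add v act_sym_incl x1 sym_incl_add by simp
  qed
  note * = this[OF assms(1)] this[OF assms(2)]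
  thus ?thesis using \<open>c \<noteq> 0\<close>
    by (auto simp: jordan_vec vec_eq_iff forall_3)
qed

text \<open>
  An \<open>R\<close>-linear map from \<open>\<^sup>eR\<close> to \<open>\<^sup>e\<^sup>'R\<close> is, on underlying sets, a map \<open>\<Psi>\<close> as below.  Put \<open>q = 3\<^sup>e\<close>,
  \<open>q' = 3\<^sup>e\<^sup>'\<close> and choose \<open>\<theta>\<close> with \<open>\<theta>\<^sup>q = t\<close>.  For two lifts \<open>(r, w)\<close> and \<open>(r', w')\<close> of the character
  with values \<open>1\<close> and \<open>\<theta>\<close>, the invariants \<open>u = r\<^sup>q x\<^sub>2 - w\<^sup>q x\<^sub>1\<close> and \<open>u'\<close> satisfy a linear relation over
  the \<open>q\<close>-th powers of invariants in which \<open>x\<^sub>2\<close> cancels: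
  \<open>r'\<^sup>q u - r\<^sup>q u' = - (r' w - r w')\<^sup>q x\<^sub>1\<close>.  Applying \<open>\<Psi>\<close> replaces \<open>q\<close> by \<open>q'\<close> and \<open>x\<^sub>1\<close> by \<open>c x\<^sub>1\<close>.  When
  \<open>r = x\<^sub>1\<^sup>2\<close> and \<open>r'\<close> are coprime, it follows that \<open>\<Psi> u + c w\<^sup>q\<^sup>' x\<^sub>1\<close> is \<open>x\<^sub>1\<^sup>2\<^sup>q\<^sup>'\<close> times some \<open>b\<close>, and the
  invariance of \<open>\<Psi> u\<close> says that the generators move \<open>b\<close> by \<open>c x\<^sub>1\<close> and \<open>c \<theta>\<^sup>q\<^sup>' x\<^sub>1\<close>.  For \<open>c \<noteq> 0\<close> this
  gives \<open>t = \<theta>\<^sup>q\<^sup>'\<close>, which is a proper iterated cube of \<open>t\<close>.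
\<close>

lemma semilinear_map_kills_x1:
  fixes \<Psi> :: "S \<Rightarrow> S"
  assumes "e < e'"
    and closed: "\<And>f. f \<in> Inv \<Longrightarrow> \<Psi> f \<in> Inv"
    and add: "\<And>f f'. f \<in> Inv \<Longrightarrow> f' \<in> Inv \<Longrightarrow> \<Psi> (f + f') = \<Psi> f + \<Psi> f'"
    and semilinear: "\<And>r f. r \<in> Inv \<Longrightarrow> f \<in> Inv \<Longrightarrow> \<Psi> (r ^ 3 ^ e * f) = r ^ 3 ^ e' * \<Psi> f"
    and x1: "\<Psi> x1 = Const c * x1"
  shows "c = 0"
proof (rule ccontr)
  assume c: "c \<noteq> 0"
  let ?q = "3 ^ e :: nat" and ?q' = "3 ^ e' :: nat"
  obtain \<theta> where \<theta>: "\<theta> ^ ?q = t_K" using K_root_exists by blast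
  obtain w1 where w1: "cocycle \<theta> (x1 ^ 2) w1" using cocycle_x1_squared by blast
  obtain r w2 where w2: "cocycle \<theta> r w2" and r: "\<not> x1 dvd r" using cocycle_trace by blast
  define u where "u r w = r ^ ?q * x2 - w ^ ?q * x1" for r w
  have u: "u r w \<in> Inv" if "cocycle \<theta> r w" for r w
    using that unfolding cocycle_def Inv_def u_def
    by (auto simp: frobenius_add \<theta>[symmetric] power_mult_distrib algebra_simps)
  let ?w = "r * w1 - x1 ^ 2 * w2"
  have w: "?w \<in> Inv" using w1 w2 unfolding cocycle_def Inv_def by (auto simp: algebra_simps)
  have rInv: "r \<in> Inv" using w2 by (simp add: cocycle_def)
  have "r ^ ?q * u (x1 ^ 2) w1 + ?w ^ ?q * x1 = (x1 ^ 2) ^ ?q * u r w2"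
    unfolding u_def frobenius_diff power_mult_distrib by (simp add: algebra_simps)
  hence "\<Psi> (r ^ ?q * u (x1 ^ 2) w1 + ?w ^ ?q * x1) = \<Psi> ((x1 ^ 2) ^ ?q * u r w2)"
    by (rule arg_cong)
  hence eq: "r ^ ?q' * \<Psi> (u (x1 ^ 2) w1) + ?w ^ ?q' * (Const c * x1) = (x1 ^ 2) ^ ?q' * \<Psi> (u r w2)"
    using u[OF w1] u[OF w2] w rInv Inv_closed(2)
    by (simp only: add semilinear Inv_closed x1)
  define f where "f = \<Psi> (u (x1 ^ 2) w1) + w1 ^ ?q' * (Const c * x1)"
  have "r ^ ?q' * f = (x1 ^ 2) ^ ?q' * (\<Psi> (u r w2) + w2 ^ ?q' * (Const c * x1))"
    using eq unfolding f_def frobenius_diff power_mult_distrib by (simp add: algebra_simps)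
  hence "x1 ^ (2 * ?q') dvd r ^ ?q' * f" by (simp add: power_mult)
  hence "x1 ^ (2 * ?q') dvd f"
    using x1_power_dvd_cancel x1_not_dvd_power r by blast
  then obtain b where b: "f = (x1 ^ 2) ^ ?q' * b" by (auto simp: dvd_def power_mult)
  have "act (jordan 1) f = f + (x1 ^ 2) ^ ?q' * (Const c * x1)"
    "act (jordan t_K) f = f + (x1 ^ 2) ^ ?q' * (Const (c * \<theta> ^ ?q') * x1)"
    using w1 closed[OF u[OF w1]] unfolding f_def cocycle_def Inv_def
    by (auto simp: frobenius_add power_mult_distrib algebra_simps)
  hence "(x1 ^ 2) ^ ?q' * act (jordan 1) b = (x1 ^ 2) ^ ?q' * (b + Const c * x1)"
    "(x1 ^ 2) ^ ?q' * act (jordan t_K) b = (x1 ^ 2) ^ ?q' * (b + Const (c * \<theta> ^ ?q') * x1)"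
    unfolding b by (simp_all add: algebra_simps)
  hence "act (jordan 1) b = b + Const c * x1"
    "act (jordan t_K) b = b + Const (c * \<theta> ^ ?q') * x1"
    by (simp_all del: power_mult)
  hence "\<theta> ^ ?q' = t_K" using translation_ratio_eq_t c by blast
  moreover have "\<theta> ^ ?q' = t_K ^ 3 ^ (e' - e)"
    using \<open>e < e'\<close> by (simp add: \<theta>[symmetric] power_mult[symmetric] power_add[symmetric])
  moreover have "3 ^ (e' - e) > (1 :: nat)"
    using \<open>e < e'\<close> by (intro one_less_power) auto
  ultimately show False using t_K_power_neq by metis
qed

section \<open>The group and its invariant ring\<close>

lemma three_cases: "x \<in> {0..<3} \<Longrightarrow> x = 0 \<or> x = 1 \<or> x = (2 :: int)"
  by auto

lemma of_int_mod_3 [simp]: "(of_int (a mod 3) :: K) = of_int a"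
proof -
  have "(of_int a :: K) = of_int (3 * (a div 3) + a mod 3)" by simp
  thus ?thesis by (simp only: of_int_add of_int_mult of_int_numeral three_K) simp
qed

lemma general_linear_simps [simp]:
  "carrier general_linear = {A. invertible A}" "g \<otimes>\<^bsub>general_linear\<^esub> h = g ** h"
  "\<one>\<^bsub>general_linear\<^esub> = mat 1"
  by (simp_all add: general_linear_def)

lemma invertible_mat_1 [simp]: "invertible (mat 1)"
  unfolding invertible_def by (rule exI[of _ "mat 1"]) simp

lemma group_general_linear: "group (general_linear :: (K ^ 3 ^ 3) monoid)"
proof (rule groupI)
  fix g :: "K ^ 3 ^ 3" assume "g \<in> carrier general_linear"
  then obtain h where "g ** h = mat 1" "h ** g = mat 1"
    by (auto simp: invertible_def)
  thus "\<exists>h\<in>carrier general_linear. h \<otimes>\<^bsub>general_linear\<^esub> g = \<one>\<^bsub>general_linear\<^esub>"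
    by (auto simp: invertible_def)
qed (auto simp: invertible_mult matrix_mul_assoc)

interpretation GL: group "general_linear :: (K ^ 3 ^ 3) monoid"
  by (rule group_general_linear)

text \<open>
  With \<open>N\<close> the nilpotent Jordan block, this is \<open>1 + l N + k N\<^sup>2\<close>.
\<close>

definition unitriangular :: "K \<Rightarrow> K \<Rightarrow> K ^ 3 ^ 3"
  where "unitriangular l k = vector [vector [1, l, k], vector [0, 1, l], vector [0, 0, 1]]"

lemma unitriangular_mult: "unitriangular l k ** unitriangular l' k' = unitriangular (l + l') (k + k' + l * l')"
  by (simp add: unitriangular_def matrix_matrix_mult_def vec_eq_iff sum_3 forall_3 algebra_simps)

lemma unitriangular_0: "unitriangular 0 0 = mat 1"
  by (simp add: unitriangular_def mat_def vec_eq_iff forall_3)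

lemma unitriangular_eq_iff: "unitriangular l k = unitriangular l' k' \<longleftrightarrow> l = l' \<and> k = k'"
  by (auto simp: unitriangular_def vec_eq_iff forall_3)

definition slope :: "int \<Rightarrow> int \<Rightarrow> K"
  where "slope a b = of_int a + of_int b * t_K"

text \<open>
  The product of \<open>a\<close> copies of the first generator and \<open>b\<close> copies of the second.  The \<open>N\<^sup>2\<close> coefficient
  is \<open>\<lambda>\<^sup>2/2\<close>, coming from \<open>exp (\<lambda> N)\<close> with \<open>\<lambda> = a + b t\<close>, plus the additive function
  \<open>- (a + b t\<^sup>2)/2\<close> of \<open>(a, b)\<close>, and \<open>1/2 = -1\<close> in characteristic three.  In this form the matrix is
  visibly a homomorphic image of \<open>(a, b)\<close> that depends only on \<open>a\<close> and \<open>b\<close> modulo three.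
\<close>

definition group_elt :: "int \<Rightarrow> int \<Rightarrow> K ^ 3 ^ 3"
  where "group_elt a b = unitriangular (slope a b) (of_int a + of_int b * t_K ^ 2 - slope a b ^ 2)"

lemma group_elt_generators: "group_elt 1 0 = jordan 1" "group_elt 0 1 = jordan t_K"
  by (simp_all add: group_elt_def slope_def unitriangular_def jordan_def)

lemma group_elt_0: "group_elt 0 0 = mat 1"
  by (simp add: group_elt_def slope_def unitriangular_0)

lemma group_elt_mult: "group_elt a b ** group_elt a' b' = group_elt (a + a') (b + b')"
proof -
  have "k + k' - (l + l') ^ 2 = (k - l ^ 2) + (k' - l' ^ 2) + l * l' - 3 * (l * l')" for k k' l l' :: K
    by (simp add: power2_eq_square algebra_simps)
  hence *: "k + k' - (l + l') ^ 2 = (k - l ^ 2) + (k' - l' ^ 2) + l * l'" for k k' l l' :: K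
    by (simp only: three_K mult_zero_left diff_zero)
  have "slope (a + a') (b + b') = slope a b + slope a' b'"
    by (simp add: slope_def algebra_simps)
  thus ?thesis
    using *[of "of_int a + of_int b * t_K ^ 2" "of_int a' + of_int b' * t_K ^ 2" "slope a b" "slope a' b'"]
    by (simp add: group_elt_def unitriangular_mult unitriangular_eq_iff algebra_simps)
qed

lemma group_elt_mod: "group_elt (a mod 3) (b mod 3) = group_elt a b"
  by (simp add: group_elt_def slope_def)

lemma slope_eq_0:
  assumes "slope a b = 0" "a \<in> {0..<3}" "b \<in> {0..<3}"
  shows "a = 0 \<and> b = 0"
proof -
  have two: "(2 :: K) = - 1" using three_K by (simp add: eq_neg_iff_add_eq_0)
  have "t_K \<noteq> -1"
  proof
    assume "t_K = -1"
    hence "t_K ^ 2 = (- 1) ^ 2" by (rule arg_cong)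
    also have "(- 1 :: K) ^ 2 = 1" by simp
    finally have "t_K ^ 2 = 1" .
    with t_K_neq(5) show False by contradiction
  qed
  with t_K_neq(1,2) have "t_K \<noteq> 0" "t_K \<noteq> 1" "t_K \<noteq> -1" by blast+
  hence "t_K \<noteq> 0" "1 + t_K \<noteq> 0" "- 1 + t_K \<noteq> 0" "1 - t_K \<noteq> 0" "- 1 - t_K \<noteq> 0"
    by (metis add_eq_0_iff minus_minus, metis add_eq_0_iff minus_minus, metis add_eq_0_iff minus_minus,
      metis right_minus_eq, metis right_minus_eq)
  thus ?thesis
    using assms(1) three_cases[OF assms(2)] three_cases[OF assms(3)]
    by (elim disjE) (simp_all add: slope_def two)
qed

lemma group_elt_inj:
  assumes "group_elt a b = group_elt a' b'" "a \<in> {0..<3}" "b \<in> {0..<3}" "a' \<in> {0..<3}" "b' \<in> {0..<3}"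
  shows "a = a' \<and> b = b'"
proof -
  have "slope ((a - a') mod 3) ((b - b') mod 3) = 0"
    using assms(1) by (simp add: group_elt_def unitriangular_eq_iff slope_def algebra_simps)
  hence "(a - a') mod 3 = 0 \<and> (b - b') mod 3 = 0"
    by (rule slope_eq_0) auto
  hence "a mod 3 = a' mod 3" "b mod 3 = b' mod 3"
    by (auto simp: mod_eq_dvd_iff)
  thus ?thesis using assms(2-) by auto
qed

lemma group_elt_invertible: "invertible (group_elt a b)"
  unfolding invertible_def
  by (rule exI[of _ "group_elt (- a) (- b)"]) (simp add: group_elt_mult group_elt_0)

lemma group_elt_inverse: "inv\<^bsub>general_linear\<^esub> (group_elt a b) = group_elt (- a) (- b)"
  by (rule GL.inv_equality) (simp_all add: group_elt_mult group_elt_0 group_elt_invertible)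

lemma group_G_eq: "group_G = subgroup_generated general_linear {jordan 1, jordan t_K}"
  by (simp add: group_G_def jordan_def)

lemma generators_subset: "{jordan 1, jordan t_K} \<subseteq> carrier general_linear"
  using group_elt_invertible[of 1 0] group_elt_invertible[of 0 1] by (simp add: group_elt_generators)

lemma group_G_simps [simp]:
  "g \<otimes>\<^bsub>group_G\<^esub> h = g ** h" "\<one>\<^bsub>group_G\<^esub> = mat 1"
  by (simp_all add: group_G_eq subgroup_generated_def)

lemma generators_in_group_G: "jordan 1 \<in> carrier group_G" "jordan t_K \<in> carrier group_G"
  unfolding group_G_eq using GL.subgroup_generated_subset_carrier_subset[OF generators_subset]
  by auto

interpretation G: group group_G
  unfolding group_G_eq by (rule GL.group_subgroup_generated)

lemma carrier_group_G: "carrier group_G = (\<lambda>(a, b). group_elt a b) ` ({0..<3} \<times> {0..<3})"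
proof
  have eq: "(\<lambda>(a, b). group_elt a b) ` ({0..<3} \<times> {0..<3}) = range (\<lambda>(a, b). group_elt a b)"
  proof
    show "range (\<lambda>(a, b). group_elt a b) \<subseteq> (\<lambda>(a, b). group_elt a b) ` ({0..<3} \<times> {0..<3})"
    proof clarify
      fix a b
      have "group_elt a b = (\<lambda>(a, b). group_elt a b) (a mod 3, b mod 3)" by (simp add: group_elt_mod)
      thus "group_elt a b \<in> (\<lambda>(a, b). group_elt a b) ` ({0..<3} \<times> {0..<3})" by (rule image_eqI) auto
    qed
  qed auto
  have "subgroup (range (\<lambda>(a, b). group_elt a b)) general_linear"
  proof (rule GL.subgroupI)
    show "x \<otimes>\<^bsub>general_linear\<^esub> y \<in> range (\<lambda>(a, b). group_elt a b)"
      if "x \<in> range (\<lambda>(a, b). group_elt a b)" "y \<in> range (\<lambda>(a, b). group_elt a b)" for x y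
      using that by (auto simp: group_elt_mult intro: range_eqI[of _ _ "(_, _)"])
    show "inv\<^bsub>general_linear\<^esub> x \<in> range (\<lambda>(a, b). group_elt a b)"
      if "x \<in> range (\<lambda>(a, b). group_elt a b)" for x
      using that by (auto simp: group_elt_inverse intro: range_eqI[of _ _ "(_, _)"])
  qed (auto simp: group_elt_invertible)
  moreover have "{jordan 1, jordan t_K} \<subseteq> range (\<lambda>(a, b). group_elt a b)"
    by (auto simp flip: group_elt_generators intro: range_eqI[of _ _ "(_, _)"])
  ultimately show "carrier group_G \<subseteq> (\<lambda>(a, b). group_elt a b) ` ({0..<3} \<times> {0..<3})"
    unfolding group_G_eq eq by (rule GL.subgroup_generated_minimal)
  have "group_elt (int n) (int m) \<in> carrier group_G" for n m
  proof (induction n)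
    case 0
    show ?case
    proof (induction m)
      case (Suc m)
      have "group_elt 0 (int (Suc m)) = jordan t_K \<otimes>\<^bsub>group_G\<^esub> group_elt 0 (int m)"
        by (simp add: group_elt_mult flip: group_elt_generators)
      thus ?case using G.m_closed[OF generators_in_group_G(2) Suc] by simp
    qed (use G.one_closed in \<open>simp add: group_elt_0\<close>)
  next
    case (Suc n)
    have "group_elt (int (Suc n)) (int m) = jordan 1 \<otimes>\<^bsub>group_G\<^esub> group_elt (int n) (int m)"
      by (simp add: group_elt_mult flip: group_elt_generators)
    thus ?case using G.m_closed[OF generators_in_group_G(1) Suc] by simp
  qed
  hence "group_elt a b \<in> carrier group_G" if "a \<in> {0..<3}" "b \<in> {0..<3}" for a b
    using that by (metis atLeastLessThan_iff int_nat_eq)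
  thus "(\<lambda>(a, b). group_elt a b) ` ({0..<3} \<times> {0..<3}) \<subseteq> carrier group_G"
    by auto
qed

lemma group_G_iso: "group_G \<cong> integer_mod_group 3 \<times>\<times> integer_mod_group 3"
proof -
  let ?Z = "integer_mod_group 3 \<times>\<times> integer_mod_group 3"
  have carrier: "carrier ?Z = {0..<3} \<times> {0..<3}"
    by (simp add: carrier_integer_mod_group)
  have "(\<lambda>(a, b). group_elt a b) \<in> iso ?Z group_G"
  proof (rule isoI)
    show "(\<lambda>(a, b). group_elt a b) \<in> hom ?Z group_G"
      unfolding hom_def carrier
      by (auto simp: carrier_group_G group_elt_mult group_elt_mod mult_integer_mod_group)
    show "bij_betw (\<lambda>(a, b). group_elt a b) (carrier ?Z) (carrier group_G)"
      unfolding bij_betw_def carrier carrier_group_G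
      by (auto intro!: inj_onI dest: group_elt_inj)
  qed
  moreover have "group ?Z"
    by (intro DirProd_group group_integer_mod_group)
  ultimately show ?thesis
    using group.iso_sym[of ?Z group_G] by (auto simp only: is_iso_def)
qed

lemma invariant_under_group_G_iff: "(\<forall>g\<in>carrier group_G. act g f = f) \<longleftrightarrow> f \<in> Inv"
proof
  assume "f \<in> Inv"
  have "subgroup {g. invertible g \<and> act g f = f} general_linear"
  proof (rule GL.subgroupI)
    fix g assume g: "g \<in> {g. invertible g \<and> act g f = f}"
    have "act (inv\<^bsub>general_linear\<^esub> g) (act g f) = f"
      unfolding act_act using GL.l_inv[of g] g by simp
    thus "inv\<^bsub>general_linear\<^esub> g \<in> {g. invertible g \<and> act g f = f}"
      using g GL.inv_closed[of g] by simp
  qed (auto simp: invertible_mult simp flip: act_act intro: exI[of _ "mat 1"])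
  moreover have "{jordan 1, jordan t_K} \<subseteq> {g. invertible g \<and> act g f = f}"
    using generators_subset \<open>f \<in> Inv\<close> by (auto simp: Inv_def)
  ultimately show "\<forall>g\<in>carrier group_G. act g f = f"
    unfolding group_G_eq using GL.subgroup_generated_minimal by blast
qed (use generators_in_group_G in \<open>auto simp: Inv_def\<close>)

section \<open>Lowest degrees of a finitely generated graded module\<close>

context rat_graded_module
begin

lemma part_closed: "x \<in> part M q \<Longrightarrow> x \<in> carrier M"
  using subgroup.subset[OF part_subgroup[of q]] by auto

lemma zero_in_part [simp]: "\<zero>\<^bsub>M\<^esub> \<in> part M q"
  using subgroup.one_closed[OF part_subgroup[of q]] by simp

lemma part_add: "x \<in> part M q \<Longrightarrow> y \<in> part M q \<Longrightarrow> x \<oplus>\<^bsub>M\<^esub> y \<in> part M q"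
  using subgroup.m_closed[OF part_subgroup[of q]] by simp

text \<open>
  The index set \<open>A\<close> may be larger than the support of \<open>c\<close>; this makes decompositions easy to add.
\<close>

definition decomposition :: "rat set \<Rightarrow> (rat \<Rightarrow> 'm) \<Rightarrow> 'm \<Rightarrow> bool"
  where "decomposition A c x \<longleftrightarrow> finite A \<and> (\<forall>q. c q \<in> part M q) \<and> (\<forall>q. q \<notin> A \<longrightarrow> c q = \<zero>\<^bsub>M\<^esub>) \<and>
    x = (\<Oplus>\<^bsub>M\<^esub>q\<in>A. c q)"

lemma decomposition_support:
  assumes "decomposition A c x"
  shows "x = (\<Oplus>\<^bsub>M\<^esub>q\<in>{q. c q \<noteq> \<zero>\<^bsub>M\<^esub>}. c q)" "finite {q. c q \<noteq> \<zero>\<^bsub>M\<^esub>}"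
proof -
  have sub: "{q. c q \<noteq> \<zero>\<^bsub>M\<^esub>} \<subseteq> A" and "finite A" and c: "c \<in> A \<rightarrow> carrier M"
    using assms part_closed by (auto simp: decomposition_def)
  thus "finite {q. c q \<noteq> \<zero>\<^bsub>M\<^esub>}" by (auto intro: finite_subset)
  have "(\<Oplus>\<^bsub>M\<^esub>q\<in>A. c q) = (\<Oplus>\<^bsub>M\<^esub>q\<in>{q. c q \<noteq> \<zero>\<^bsub>M\<^esub>}. c q)"
    using M.add.finprod_mono_neutral_cong_right[OF \<open>finite A\<close> sub _ refl c] by simp
  thus "x = (\<Oplus>\<^bsub>M\<^esub>q\<in>{q. c q \<noteq> \<zero>\<^bsub>M\<^esub>}. c q)"
    using assms by (simp add: decomposition_def)
qed

lemma decomposition_unique: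
  assumes "decomposition A c x" "decomposition A' c' x" "x \<in> carrier M"
  shows "c = c'"
proof -
  define P where "P b \<longleftrightarrow> (\<forall>q. b q \<in> part M q) \<and> finite {q. b q \<noteq> \<zero>\<^bsub>M\<^esub>} \<and>
    x = (\<Oplus>\<^bsub>M\<^esub>q\<in>{q. b q \<noteq> \<zero>\<^bsub>M\<^esub>}. b q)" for b
  have "\<exists>!b. P b" unfolding P_def by (rule part_decomposition[OF assms(3)])
  moreover have "P b" if "decomposition B b x" for B b
    unfolding P_def using that decomposition_support[OF that] by (simp add: decomposition_def)
  hence "P c" "P c'" using assms by blast+
  ultimately show ?thesis by blast
qed

lemma decomposition_superset:
  assumes "decomposition A c x" "finite B" "A \<subseteq> B"
  shows "decomposition B c x"
proof -
  have "c \<in> B \<rightarrow> carrier M" using assms part_closed by (auto simp: decomposition_def)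
  hence "(\<Oplus>\<^bsub>M\<^esub>q\<in>A. c q) = (\<Oplus>\<^bsub>M\<^esub>q\<in>B. c q)"
    using assms
    by (intro M.add.finprod_mono_neutral_cong_left) (auto simp: decomposition_def)
  thus ?thesis using assms by (auto simp: decomposition_def)
qed

lemma decomposition_add:
  assumes "decomposition A c x" "decomposition A' c' x'"
  shows "decomposition (A \<union> A') (\<lambda>q. c q \<oplus>\<^bsub>M\<^esub> c' q) (x \<oplus>\<^bsub>M\<^esub> x')"
proof -
  let ?B = "A \<union> A'"
  have *: "decomposition ?B c x" "decomposition ?B c' x'"
    using assms decomposition_superset by (auto simp: decomposition_def)
  have "c q \<in> carrier M" "c' q \<in> carrier M" for q
    using assms part_closed[of "c q" q] part_closed[of "c' q" q] by (simp_all add: decomposition_def)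
  hence "c \<in> ?B \<rightarrow> carrier M" "c' \<in> ?B \<rightarrow> carrier M"
    by blast+
  thus ?thesis using * by (auto simp: decomposition_def M.finsum_addf part_add)
qed

lemma decomposition_homogeneous:
  assumes "z \<in> part M q"
  shows "decomposition {q} (\<lambda>p. if p = q then z else \<zero>\<^bsub>M\<^esub>) z"
  using assms part_closed[OF assms] by (auto simp: decomposition_def)

text \<open>
  The elements whose component of degree \<open>\<delta>\<close> vanishes, phrased without choosing a component function.
\<close>

definition without_degree :: "rat \<Rightarrow> 'm set"
  where "without_degree \<delta> = {x \<in> carrier M. \<exists>A c. decomposition A c x \<and> c \<delta> = \<zero>\<^bsub>M\<^esub>}"

lemma without_degree_homogeneous: "z \<in> part M q \<Longrightarrow> q \<noteq> \<delta> \<Longrightarrow> z \<in> without_degree \<delta>"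
  using decomposition_homogeneous part_closed by (fastforce simp: without_degree_def)

lemma without_degree_zero: "\<zero>\<^bsub>M\<^esub> \<in> without_degree \<delta>"
  using without_degree_homogeneous[of _ "\<delta> + 1" \<delta>] by simp

lemma without_degree_add:
  assumes "x \<in> without_degree \<delta>" "x' \<in> without_degree \<delta>"
  shows "x \<oplus>\<^bsub>M\<^esub> x' \<in> without_degree \<delta>"
proof -
  obtain A c A' c' where "decomposition A c x" "c \<delta> = \<zero>\<^bsub>M\<^esub>" "decomposition A' c' x'" "c' \<delta> = \<zero>\<^bsub>M\<^esub>"
    using assms by (auto simp: without_degree_def)
  hence "decomposition (A \<union> A') (\<lambda>q. c q \<oplus>\<^bsub>M\<^esub> c' q) (x \<oplus>\<^bsub>M\<^esub> x') \<and> c \<delta> \<oplus>\<^bsub>M\<^esub> c' \<delta> = \<zero>\<^bsub>M\<^esub>"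
    using decomposition_add by simp
  thus ?thesis using assms by (auto simp: without_degree_def)
qed

lemma without_degree_finsum:
  assumes "\<And>i. i \<in> I \<Longrightarrow> f i \<in> without_degree \<delta>"
  shows "(\<Oplus>\<^bsub>M\<^esub>i\<in>I. f i) \<in> without_degree \<delta>"
  using assms
proof (induction I rule: infinite_finite_induct)
  case (insert i I)
  hence "f \<in> I \<rightarrow> carrier M" "f i \<in> carrier M" by (auto simp: without_degree_def)
  thus ?case using insert by (auto intro: without_degree_add)
qed (auto simp: without_degree_zero)

lemma part_without_degree: "y \<in> part M \<delta> \<Longrightarrow> y \<in> without_degree \<delta> \<Longrightarrow> y = \<zero>\<^bsub>M\<^esub>"
proof -
  assume y: "y \<in> part M \<delta>" "y \<in> without_degree \<delta>"
  then obtain A c where c: "decomposition A c y" "c \<delta> = \<zero>\<^bsub>M\<^esub>" by (auto simp: without_degree_def)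
  have "(\<lambda>p. if p = \<delta> then y else \<zero>\<^bsub>M\<^esub>) = c"
    by (rule decomposition_unique[OF decomposition_homogeneous[OF y(1)] c(1) part_closed[OF y(1)]])
  from fun_cong[OF this, of \<delta>] c(2) show ?thesis by simp
qed

text \<open>
  Let \<open>y\<close> be homogeneous of degree \<open>\<delta>\<close>, with nothing in the degrees \<open>\<delta> - 1, \<delta> - 2, \<dots>\<close>.  In an expression
  of \<open>y\<close> through generators, the only contributions of degree \<open>\<delta>\<close> come from the degree zero part of \<open>R\<close>
  times the degree \<open>\<delta>\<close> components of the generators.  Hence \<open>\<delta>\<close> is the degree of one of the finitely many
  homogeneous components of the generators.  The hypothesis \<open>induct\<close> says that \<open>R\<close> is additively generated
  by its homogeneous elements.
\<close>

lemma lowest_degrees_finite: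
  assumes fg: "finitely_generated_module R M"
    and ring_part: "\<And>i. ring_part R i \<subseteq> carrier R"
    and induct: "\<And>P r. r \<in> carrier R \<Longrightarrow> (\<And>i r. r \<in> ring_part R i \<Longrightarrow> P r) \<Longrightarrow>
      (\<And>r s. r \<in> carrier R \<Longrightarrow> s \<in> carrier R \<Longrightarrow> P r \<Longrightarrow> P s \<Longrightarrow> P (r \<oplus> s)) \<Longrightarrow> P r"
  obtains D where "finite D"
    "\<And>\<delta> y. y \<in> part M \<delta> \<Longrightarrow> y \<noteq> \<zero>\<^bsub>M\<^esub> \<Longrightarrow>
      (\<And>i::nat. i \<ge> 1 \<Longrightarrow> part M (\<delta> - of_nat i) \<subseteq> {\<zero>\<^bsub>M\<^esub>}) \<Longrightarrow> \<delta> \<in> D"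
proof -
  obtain S where S: "finite S" "S \<subseteq> carrier M"
    and gen: "carrier M = {(\<Oplus>\<^bsub>M\<^esub>s\<in>S. c s \<odot>\<^bsub>M\<^esub> s) | c. c \<in> S \<rightarrow> carrier R}"
    using fg unfolding finitely_generated_module_def by blast
  have "\<forall>s\<in>S. \<exists>c. decomposition {q. c q \<noteq> \<zero>\<^bsub>M\<^esub>} c s"
    using part_decomposition S(2) unfolding decomposition_def by blast
  then obtain c where c: "\<And>s. s \<in> S \<Longrightarrow> decomposition {q. c s q \<noteq> \<zero>\<^bsub>M\<^esub>} (c s) s"
    by metis
  define D where "D = (\<Union>s\<in>S. {q. c s q \<noteq> \<zero>\<^bsub>M\<^esub>})"
  have "\<delta> \<in> D"
    if y: "y \<in> part M \<delta>" "y \<noteq> \<zero>\<^bsub>M\<^esub>"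
      and low: "\<And>i::nat. i \<ge> 1 \<Longrightarrow> part M (\<delta> - of_nat i) \<subseteq> {\<zero>\<^bsub>M\<^esub>}" for \<delta> y
  proof (rule ccontr)
    assume \<delta>: "\<delta> \<notin> D"
    have hom: "r \<odot>\<^bsub>M\<^esub> c s q \<in> without_degree \<delta>" if r: "r \<in> ring_part R i" and s: "s \<in> S" for r i s q
    proof (cases "of_nat i + q = \<delta>")
      case True
      have q: "c s q \<in> part M q" using c[OF s] by (simp add: decomposition_def)
      have "c s q = \<zero>\<^bsub>M\<^esub>"
      proof (cases "i = 0")
        case True
        thus ?thesis using \<open>of_nat i + q = \<delta>\<close> \<delta> s by (auto simp: D_def)
      next
        case False
        have "q = \<delta> - of_nat i" using \<open>of_nat i + q = \<delta>\<close> by simp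
        thus ?thesis using low[of i] q False by auto
      qed
      thus ?thesis using r ring_part[of i] by (auto simp: without_degree_zero)
    next
      case False
      thus ?thesis using c[OF s] r smult_part[OF r]
        by (intro without_degree_homogeneous) (auto simp: decomposition_def)
    qed
    have "r \<odot>\<^bsub>M\<^esub> s \<in> without_degree \<delta>" if "r \<in> carrier R" "s \<in> S" for r s
      using that(1)
    proof (induction r rule: induct)
      case (2 i r)
      have fin: "finite {q. c s q \<noteq> \<zero>\<^bsub>M\<^esub>}" and s: "s = (\<Oplus>\<^bsub>M\<^esub>q\<in>{q. c s q \<noteq> \<zero>\<^bsub>M\<^esub>}. c s q)"
        and cs: "c s \<in> {q. c s q \<noteq> \<zero>\<^bsub>M\<^esub>} \<rightarrow> carrier M"
        using c[OF \<open>s \<in> S\<close>] part_closed by (auto simp: decomposition_def)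
      have "r \<in> carrier R" using 2 ring_part by auto
      hence "r \<odot>\<^bsub>M\<^esub> s = (\<Oplus>\<^bsub>M\<^esub>q\<in>{q. c s q \<noteq> \<zero>\<^bsub>M\<^esub>}. r \<odot>\<^bsub>M\<^esub> c s q)"
        by (subst s) (rule finsum_smult_ldistr[OF fin _ cs])
      thus ?case using hom[OF 2(1) \<open>s \<in> S\<close>] by (simp add: without_degree_finsum)
    next
      case (3 r r')
      moreover have "s \<in> carrier M" using S(2) \<open>s \<in> S\<close> by blast
      ultimately show ?case by (simp add: smult_l_distr without_degree_add)
    qed (use that(1) in auto)
    moreover obtain b where "y = (\<Oplus>\<^bsub>M\<^esub>s\<in>S. b s \<odot>\<^bsub>M\<^esub> s)" "b \<in> S \<rightarrow> carrier R"
      using gen part_closed[OF y(1)] by blast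
    ultimately have "y \<in> without_degree \<delta>" by (auto intro!: without_degree_finsum)
    thus False using part_without_degree y by blast
  qed
  moreover have "finite D"
    using S(1) c by (auto simp: D_def decomposition_def)
  ultimately show thesis using that by blast
qed

end

section \<open>Failure of finite Frobenius representation type\<close>

abbreviation InvRing :: "S graded_ring" where "InvRing \<equiv> invariant_ring group_G"

lemma InvRing_simps [simp]:
  "carrier InvRing = Inv" "r \<otimes>\<^bsub>InvRing\<^esub> s = r * s" "r \<oplus>\<^bsub>InvRing\<^esub> s = r + s" "\<one>\<^bsub>InvRing\<^esub> = 1"
  "\<zero>\<^bsub>InvRing\<^esub> = 0" "ring_part InvRing n = homogeneous_part n \<inter> Inv"
  by (auto simp: invariant_ring_def invariant_under_group_G_iff)

lemma InvRing_part_subset: "ring_part InvRing i \<subseteq> carrier InvRing"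
  by simp

lemma InvRing_power [simp]: "r [^]\<^bsub>InvRing\<^esub> (n :: nat) = r ^ n"
  by (induction n) (simp_all add: nat_pow_def mult.commute)

lemma InvRing_induct:
  assumes "r \<in> Inv" "\<And>i r. r \<in> homogeneous_part i \<inter> Inv \<Longrightarrow> P r"
    "\<And>r s. r \<in> Inv \<Longrightarrow> s \<in> Inv \<Longrightarrow> P r \<Longrightarrow> P s \<Longrightarrow> P (r + s)"
  shows "P r"
proof -
  have hom: "hom_component i r \<in> Inv" for i
    using assms(1) by (simp add: Inv_def flip: hom_component_act)
  have "(\<Sum>i\<in>I. hom_component i r) \<in> Inv \<and> P (\<Sum>i\<in>I. hom_component i r)" for I
    by (induction I rule: infinite_finite_induct)
       (use assms(2)[of 0 0] assms(2)[of "hom_component _ r"] in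
         \<open>auto intro!: assms(3) Inv_closed hom hom_component_homogeneous\<close>)
  thus ?thesis by (subst mpoly_eq_sum_hom_components) blast
qed

lemma linear_invariants:
  assumes "f \<in> homogeneous_part 1" "f \<in> Inv"
  obtains c where "f = Const c * x1"
proof -
  obtain v where v: "f = sym_incl v" using assms(1) unfolding homogeneous_part_1_eq by blast
  hence "jordan 1 *v v = v"
    using assms(2) by (simp add: Inv_def act_sym_incl)
  hence "v = vector [v $ 1, 0, 0]"
    by (auto simp: jordan_vec vec_eq_iff forall_3)
  hence "sym_incl v = sym_incl (vector [v $ 1, 0, 0])" by (rule arg_cong)
  hence "f = Const (v $ 1) * x1" by (simp add: v sym_incl_vector)
  thus thesis using that by blast
qed

text \<open>
  What remains of a direct sum decomposition of \<open>\<^sup>eR\<close> for a summand \<open>M\<close>, up to a shift, to which \<open>x\<^sub>1\<close>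
  contributes a nonzero element: the projection \<open>\<rho>\<close>, the inclusion \<open>\<iota>\<close>, and the degree \<open>\<delta>\<close> of this
  element in the grading of \<open>M\<close>.  The last two clauses record that
  \<open>\<delta>\<close> corresponds to degree \<open>1/3\<^sup>e\<close> in \<open>\<^sup>eR\<close>, where only \<open>[R]\<^sub>1\<close> lives, and that there is nothing in the
  negative degrees \<open>1/3\<^sup>e - i\<close>.
\<close>

definition x1_summand :: "nat \<Rightarrow> (S, 'm) graded_module \<Rightarrow> rat \<Rightarrow> (S \<Rightarrow> 'm) \<Rightarrow> ('m \<Rightarrow> S) \<Rightarrow> bool"
  where "x1_summand e M \<delta> \<rho> \<iota> \<longleftrightarrow>
    (\<forall>f\<in>Inv. \<rho> f \<in> carrier M) \<and>
    (\<forall>f\<in>Inv. \<forall>f'\<in>Inv. \<rho> (f + f') = \<rho> f \<oplus>\<^bsub>M\<^esub> \<rho> f') \<and>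
    (\<forall>r\<in>Inv. \<forall>f\<in>Inv. \<rho> (r ^ 3 ^ e * f) = r \<odot>\<^bsub>M\<^esub> \<rho> f) \<and>
    (\<forall>m\<in>carrier M. \<iota> m \<in> Inv) \<and>
    (\<forall>m\<in>carrier M. \<forall>m'\<in>carrier M. \<iota> (m \<oplus>\<^bsub>M\<^esub> m') = \<iota> m + \<iota> m') \<and>
    (\<forall>r\<in>Inv. \<forall>m\<in>carrier M. \<iota> (r \<odot>\<^bsub>M\<^esub> m) = r ^ 3 ^ e * \<iota> m) \<and>
    (\<forall>m\<in>carrier M. \<iota> m = 0 \<longrightarrow> m = \<zero>\<^bsub>M\<^esub>) \<and>
    \<rho> x1 \<in> part M \<delta> \<and> \<rho> x1 \<noteq> \<zero>\<^bsub>M\<^esub> \<and>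
    (\<forall>m\<in>part M \<delta>. \<iota> m \<in> homogeneous_part 1) \<and>
    (\<forall>i::nat. i \<ge> 1 \<longrightarrow> part M (\<delta> - of_nat i) \<subseteq> {\<zero>\<^bsub>M\<^esub>})"

lemma frobenius_module_simps [simp]:
  "carrier (frobenius_module p e InvRing) = Inv"
  "f \<oplus>\<^bsub>frobenius_module p e InvRing\<^esub> f' = f + f'"
  "r \<odot>\<^bsub>frobenius_module p e InvRing\<^esub> f = r ^ p ^ e * f"
  by (simp_all add: frobenius_module_def)

lemma direct_sum_simps [simp]:
  "carrier (direct_sum_module n N) = (\<Pi>\<^sub>E j\<in>{..<n}. carrier (N j))"
  "x \<oplus>\<^bsub>direct_sum_module n N\<^esub> y = (\<lambda>j\<in>{..<n}. x j \<oplus>\<^bsub>N j\<^esub> y j)"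
  "r \<odot>\<^bsub>direct_sum_module n N\<^esub> x = (\<lambda>j\<in>{..<n}. r \<odot>\<^bsub>N j\<^esub> x j)"
  "part (direct_sum_module n N) q = (\<Pi>\<^sub>E j\<in>{..<n}. part (N j) q)"
  by (simp_all add: direct_sum_module_def)

lemma shift_module_simps [simp]:
  "carrier (shift_module M d) = carrier M" "x \<oplus>\<^bsub>shift_module M d\<^esub> y = x \<oplus>\<^bsub>M\<^esub> y"
  "r \<odot>\<^bsub>shift_module M d\<^esub> x = r \<odot>\<^bsub>M\<^esub> x" "part (shift_module M d) q = part M (d + q)"
  "\<zero>\<^bsub>shift_module M d\<^esub> = \<zero>\<^bsub>M\<^esub>"
  by (simp_all add: shift_module_def)

text \<open>
  As an isomorphism does not kill \<open>x\<^sub>1\<close>, some component of its image is nonzero.  The degree clauses hold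
  because the inclusion of a summand preserves degrees up to the shift \<open>d j\<close>.
\<close>

lemma x1_summand_exists:
  fixes Ms :: "(S, 'm) graded_module list"
  assumes e: "e \<ge> 1"
    and Ms: "\<forall>M\<in>set Ms. rat_graded_module InvRing M"
    and N: "\<forall>j<n. N j \<in> set Ms"
    and iso: "graded_module_iso InvRing (frobenius_module 3 e InvRing)
      (direct_sum_module n (\<lambda>j. shift_module (N j) (d j)))"
  obtains M \<delta> \<rho> \<iota> where "M \<in> set Ms" "x1_summand e M \<delta> \<rho> \<iota>"
proof -
  let ?F = "frobenius_module 3 e InvRing" and ?X = "direct_sum_module n (\<lambda>j. shift_module (N j) (d j))"
  obtain \<phi> where bij: "bij_betw \<phi> Inv (carrier ?X)"
    and add: "\<And>f f'. f \<in> Inv \<Longrightarrow> f' \<in> Inv \<Longrightarrow> \<phi> (f + f') = \<phi> f \<oplus>\<^bsub>?X\<^esub> \<phi> f'"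
    and smult: "\<And>r f. r \<in> Inv \<Longrightarrow> f \<in> Inv \<Longrightarrow> \<phi> (r ^ 3 ^ e * f) = r \<odot>\<^bsub>?X\<^esub> \<phi> f"
    and part: "\<And>q. \<phi> ` part ?F q = part ?X q"
    using iso unfolding graded_module_iso_def by auto
  have mod: "rat_graded_module InvRing (N j)" if "j < n" for j
    using Ms N that by auto
  note R_module = rat_graded_module.axioms(1)[OF mod]
  note abelian = R_module[THEN module.axioms(2)]
  have closed: "\<phi> f j \<in> carrier (N j)" if "f \<in> Inv" "j < n" for f j
    using bij_betwE[OF bij] that by fastforce
  have undef: "\<phi> f j = undefined" if "f \<in> Inv" "\<not> j < n" for f j
    using bij_betwE[OF bij] that by (fastforce simp: PiE_def extensional_def)
  have inj: "f = f'" if "f \<in> Inv" "f' \<in> Inv" "\<phi> f = \<phi> f'" for f f'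
    using bij that by (auto simp: bij_betw_def inj_on_def)
  have phi_0: "\<phi> 0 j = \<zero>\<^bsub>N j\<^esub>" if "j < n" for j
  proof -
    interpret abelian_group "N j" by (rule abelian[OF that])
    have "\<phi> 0 j \<oplus>\<^bsub>N j\<^esub> \<phi> 0 j = \<phi> 0 j"
      using fun_cong[OF add[of 0 0], of j] that by (simp add: Inv_closed)
    thus ?thesis using closed[of 0 j] that by (auto simp: Inv_closed)
  qed
  have "\<exists>j<n. \<phi> x1 j \<noteq> \<zero>\<^bsub>N j\<^esub>"
  proof (rule ccontr)
    assume "\<not> ?thesis"
    hence "\<phi> x1 i = \<phi> 0 i" for i
      using phi_0[of i] undef[of x1 i] undef[of 0 i] Inv_closed(1,2) by (cases "i < n") auto
    hence "\<phi> x1 = \<phi> 0" by (rule ext)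
    thus False using inj[of x1 0] by (auto simp: Inv_closed)
  qed
  then obtain j where j: "j < n" and nz: "\<phi> x1 j \<noteq> \<zero>\<^bsub>N j\<^esub>" by blast
  interpret M: rat_graded_module InvRing "N j" by (rule mod[OF j])
  have zero: "\<zero>\<^bsub>N i\<^esub> \<in> carrier (N i)" "\<zero>\<^bsub>N i\<^esub> \<oplus>\<^bsub>N i\<^esub> \<zero>\<^bsub>N i\<^esub> = \<zero>\<^bsub>N i\<^esub>"
    "r \<in> Inv \<Longrightarrow> r \<odot>\<^bsub>N i\<^esub> \<zero>\<^bsub>N i\<^esub> = \<zero>\<^bsub>N i\<^esub>" if "i < n" for i r
  proof -
    interpret rat_graded_module InvRing "N i" by (rule mod[OF that])
    show "\<zero>\<^bsub>N i\<^esub> \<in> carrier (N i)" "\<zero>\<^bsub>N i\<^esub> \<oplus>\<^bsub>N i\<^esub> \<zero>\<^bsub>N i\<^esub> = \<zero>\<^bsub>N i\<^esub>" by simp_all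
    show "r \<odot>\<^bsub>N i\<^esub> \<zero>\<^bsub>N i\<^esub> = \<zero>\<^bsub>N i\<^esub>" if "r \<in> Inv" using that by simp
  qed
  \<comment> \<open>The inclusion of the \<open>j\<close>-th summand into the direct sum.\<close>
  define put where "put m = (\<lambda>i\<in>{..<n}. if i = j then m else \<zero>\<^bsub>N i\<^esub>)" for m
  have put_closed: "put m \<in> carrier ?X" if "m \<in> carrier (N j)" for m
    using that zero by (auto simp: put_def)
  define \<iota> where "\<iota> m = inv_into Inv \<phi> (put m)" for m
  have \<iota>: "\<iota> m \<in> Inv" "\<phi> (\<iota> m) = put m" if "m \<in> carrier (N j)" for m
    using put_closed[OF that] bij unfolding \<iota>_def bij_betw_def
    by (metis inv_into_into, metis f_inv_into_f)
  define \<delta> where "\<delta> = d j + 1 / 3 ^ e"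
  have x1_part: "x1 \<in> part ?F (1 / 3 ^ e)"
    using homogeneous_part_Var[of 1] Inv_closed(2)
    by (auto simp: frobenius_module_def intro!: exI[of _ 1])
  have \<iota>_part: "\<iota> m \<in> part ?F (q - d j)" if m: "m \<in> part (N j) q" for m q
  proof -
    have "put m \<in> part ?X (q - d j)"
      using m rat_graded_module.zero_in_part[OF mod] by (auto simp: put_def)
    then obtain f where f: "f \<in> part ?F (q - d j)" "\<phi> f = put m"
      unfolding part[symmetric] by auto
    moreover have "f \<in> Inv" using f(1) by (auto simp: frobenius_module_def Inv_closed)
    ultimately show ?thesis using inj \<iota>[OF M.part_closed[OF m]] by metis
  qed
  have "x1_summand e (N j) \<delta> (\<lambda>f. \<phi> f j) \<iota>"
    unfolding x1_summand_def
  proof (intro conjI ballI allI impI)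
    show "\<phi> x1 j \<in> part (N j) \<delta>"
    proof -
      have "\<phi> x1 \<in> part ?X (1 / 3 ^ e)" using x1_part part by blast
      thus ?thesis using j by (auto simp: \<delta>_def dest!: PiE_mem[of _ _ _ j])
    qed
    show "\<iota> m \<in> homogeneous_part 1" if m: "m \<in> part (N j) \<delta>" for m
    proof -
      have "\<iota> m \<in> part ?F (1 / 3 ^ e)" using \<iota>_part[OF m] by (simp add: \<delta>_def)
      then consider "\<iota> m = 0"
        | k where "1 / 3 ^ e = of_nat k / (3 ^ e :: rat)" "\<iota> m \<in> homogeneous_part k"
        by (auto simp: frobenius_module_def)
      thus ?thesis
      proof cases
        case 2
        hence "of_nat k = (1 :: rat)" by simp
        hence "k = 1" by (metis of_nat_eq_1_iff)
        thus ?thesis using 2 by simp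
      qed simp
    qed
    show "part (N j) (\<delta> - of_nat i) \<subseteq> {\<zero>\<^bsub>N j\<^esub>}" if i: "i \<ge> 1" for i :: nat
    proof
      fix m assume m: "m \<in> part (N j) (\<delta> - of_nat i)"
      have neq: "1 / 3 ^ e - of_nat i \<noteq> of_nat k / (3 ^ e :: rat)" for k
      proof -
        have "1 / 3 ^ e < (1 :: rat)" using e by (simp add: one_less_power)
        moreover have "of_nat i \<ge> (1 :: rat)" using i by simp
        moreover have "of_nat k / 3 ^ e \<ge> (0 :: rat)" by simp
        ultimately show ?thesis by linarith
      qed
      hence "\<iota> m = 0" using \<iota>_part[OF m] by (auto simp: \<delta>_def frobenius_module_def)
      hence "put m j = \<zero>\<^bsub>N j\<^esub>" using \<iota>(2)[OF M.part_closed[OF m]] phi_0[OF j] by simp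
      thus "m \<in> {\<zero>\<^bsub>N j\<^esub>}" using j by (simp add: put_def)
    qed
    show "m = \<zero>\<^bsub>N j\<^esub>" if "m \<in> carrier (N j)" "\<iota> m = 0" for m
      using \<iota>(2)[OF that(1)] that(2) phi_0[OF j] j by (auto simp: put_def dest: fun_cong[of _ _ j])
    show "\<iota> (m \<oplus>\<^bsub>N j\<^esub> m') = \<iota> m + \<iota> m'" if m: "m \<in> carrier (N j)" "m' \<in> carrier (N j)" for m m'
    proof (rule inj)
      have "put (m \<oplus>\<^bsub>N j\<^esub> m') = put m \<oplus>\<^bsub>?X\<^esub> put m'"
        using zero by (auto simp: put_def fun_eq_iff)
      thus "\<phi> (\<iota> (m \<oplus>\<^bsub>N j\<^esub> m')) = \<phi> (\<iota> m + \<iota> m')"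
        using \<iota> add m by simp
    qed (use \<iota> m in \<open>auto intro: Inv_closed\<close>)
    show "\<iota> (r \<odot>\<^bsub>N j\<^esub> m) = r ^ 3 ^ e * \<iota> m" if m: "m \<in> carrier (N j)" and r: "r \<in> Inv" for m r
    proof (rule inj)
      have "put (r \<odot>\<^bsub>N j\<^esub> m) = r \<odot>\<^bsub>?X\<^esub> put m"
        using zero r by (auto simp: put_def fun_eq_iff)
      thus "\<phi> (\<iota> (r \<odot>\<^bsub>N j\<^esub> m)) = \<phi> (r ^ 3 ^ e * \<iota> m)"
        using \<iota> smult m r by simp
    qed (use \<iota> m r in \<open>auto intro: Inv_closed\<close>)
  qed (use j nz \<iota> closed in \<open>auto simp: add smult\<close>)
  thus thesis using that N j by blast
qed

text \<open>
  Composing the projection of one Frobenius twist onto \<open>M\<close> with the inclusion of \<open>M\<close> into another one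
  sends \<open>x\<^sub>1\<close> to a nonzero multiple of \<open>x\<^sub>1\<close>, since \<open>[R]\<^sub>1\<close> is spanned by \<open>x\<^sub>1\<close>.
\<close>

lemma x1_summand_same_not_less:
  assumes "x1_summand e M \<delta> \<rho> \<iota>" "x1_summand e' M \<delta> \<rho>' \<iota>'"
  shows "\<not> e < e'"
proof
  assume "e < e'"
  have "\<iota>' (\<rho> x1) \<in> homogeneous_part 1" "\<iota>' (\<rho> x1) \<in> Inv" "\<iota>' (\<rho> x1) \<noteq> 0"
    using assms Inv_closed(2) unfolding x1_summand_def by auto
  then obtain c where c: "\<iota>' (\<rho> x1) = Const c * x1" "c \<noteq> 0"
    using linear_invariants by (metis Const_0 mult_zero_left)
  have "c = 0"
    by (rule semilinear_map_kills_x1[OF \<open>e < e'\<close>, of "\<lambda>f. \<iota>' (\<rho> f)"])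
       (use assms c in \<open>auto simp: x1_summand_def\<close>)
  with c show False by blast
qed

text \<open>
  For each \<open>e\<close>, the element \<open>x\<^sub>1\<close> selects one of the finitely many modules and one of its finitely many
  lowest degrees, so two different values of \<open>e\<close> select the same pair.
\<close>

lemma not_has_FFRT: "\<not> has_FFRT TYPE('m) 3 InvRing"
proof
  assume "has_FFRT TYPE('m) 3 InvRing"
  then obtain Ms :: "(S, 'm) graded_module list"
    where Ms: "\<forall>M\<in>set Ms. rat_graded_module InvRing M \<and> finitely_generated_module InvRing M"
      and iso: "\<forall>e\<ge>1. \<exists>n N d. (\<forall>j<n. N j \<in> set Ms) \<and> graded_module_iso InvRing
        (frobenius_module 3 e InvRing) (direct_sum_module n (\<lambda>j. shift_module (N j) (d j)))"
    unfolding has_FFRT_def by blast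
  have "\<exists>M \<delta> \<rho> \<iota>. M \<in> set Ms \<and> x1_summand e M \<delta> \<rho> \<iota>" if e: "e \<ge> 1" for e
  proof -
    obtain n N d where *: "\<forall>j<n. N j \<in> set Ms" "graded_module_iso InvRing
        (frobenius_module 3 e InvRing) (direct_sum_module n (\<lambda>j. shift_module (N j) (d j)))"
      using iso[THEN spec, THEN mp, OF e] by (elim exE conjE)
    have "\<forall>M\<in>set Ms. rat_graded_module InvRing M"
      using Ms by (simp add: ball_conj_distrib)
    thus ?thesis by (rule x1_summand_exists[OF e _ *]) blast
  qed
  then obtain M \<delta> \<rho> \<iota> where summand: "\<And>e. e \<ge> 1 \<Longrightarrow> M e \<in> set Ms"
    "\<And>e. e \<ge> 1 \<Longrightarrow> x1_summand e (M e) (\<delta> e) (\<rho> e) (\<iota> e)"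
    by metis
  have "\<exists>D. finite D \<and> (\<forall>\<delta> y. y \<in> part L \<delta> \<longrightarrow> y \<noteq> \<zero>\<^bsub>L\<^esub> \<longrightarrow>
      (\<forall>i::nat. i \<ge> 1 \<longrightarrow> part L (\<delta> - of_nat i) \<subseteq> {\<zero>\<^bsub>L\<^esub>}) \<longrightarrow> \<delta> \<in> D)" if "L \<in> set Ms" for L
  proof -
    interpret rat_graded_module InvRing L using Ms that by blast
    have "finitely_generated_module InvRing L" using Ms that by blast
    moreover have "P r" if "r \<in> carrier InvRing" "\<And>i r. r \<in> ring_part InvRing i \<Longrightarrow> P r"
      "\<And>r s. r \<in> carrier InvRing \<Longrightarrow> s \<in> carrier InvRing \<Longrightarrow> P r \<Longrightarrow> P s \<Longrightarrow> P (r \<oplus>\<^bsub>InvRing\<^esub> s)"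
      for P r
      by (rule InvRing_induct) (use that in simp_all)
    ultimately show ?thesis
      by (rule lowest_degrees_finite[OF _ InvRing_part_subset]) blast+
  qed
  then obtain D where D: "\<And>L. L \<in> set Ms \<Longrightarrow> finite (D L)"
    "\<And>L \<delta> y. L \<in> set Ms \<Longrightarrow> y \<in> part L \<delta> \<Longrightarrow> y \<noteq> \<zero>\<^bsub>L\<^esub> \<Longrightarrow>
      (\<And>i::nat. i \<ge> 1 \<Longrightarrow> part L (\<delta> - of_nat i) \<subseteq> {\<zero>\<^bsub>L\<^esub>}) \<Longrightarrow> \<delta> \<in> D L"
    by metis
  have "(\<lambda>e. (M e, \<delta> e)) ` {1..} \<subseteq> Sigma (set Ms) D"
    using summand D(2) by (fastforce simp: x1_summand_def)
  moreover have "finite (Sigma (set Ms) D)" using D(1) by auto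
  ultimately have "finite ((\<lambda>e. (M e, \<delta> e)) ` {1..})" by (rule finite_subset)
  hence "\<not> inj_on (\<lambda>e. (M e, \<delta> e)) {1..}"
    using infinite_Ici finite_imageD by blast
  then obtain e e' where e: "e \<ge> 1" "e' \<ge> 1" "M e = M e'" "\<delta> e = \<delta> e'" "e \<noteq> e'"
    by (auto simp: inj_on_def)
  hence "\<not> e < e'" "\<not> e' < e"
    using x1_summand_same_not_less summand(2) by metis+
  with \<open>e \<noteq> e'\<close> show False by simp
qed

theorem theorem3p1:
  shows "group_G \<cong> integer_mod_group 3 \<times>\<times> integer_mod_group 3
    \<and> \<not> has_FFRT TYPE('m) 3 (invariant_ring group_G)"
  using group_G_iso not_has_FFRT by blast

end
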